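(* For a natural number $k\ge 1$ let $C_k=\Gamma(k+1)/(2^{k/2}\,\Gamma(k/2+1))$. Uniformly for real $x$ and even natural numbers $k\le (\log\log x)^{1/3}$ we have $$\sum_{n\le x} (\omega(n)-\log\log x)^{k} = C_k\, x\,(\log\log x)^{k/2}\Big(1+O\Big(\frac{k^{3/2}}{\sqrt{\log\log x}}\Big)\Big),$$ and uniformly for real $x$ and odd natural numbers $k\le (\log\log x)^{1/3}$ we have $$\sum_{n\le x} (\omega(n)-\log\log x)^{k} \ll C_k\, x\,(\log\log x)^{k/2}\,\frac{k^{3/2}}{\sqrt{\log\log x}}.$$
   Context: $\omega(n)$ denotes the number of distinct prime factors of the natural number $n$. Sums over $n\le x$ run over natural numbers $1\le n\le x$. The implied constants in $O(\cdot)$ and $\ll$ are absolute (in particular independent of $x$ and $k$); $A\ll B$ means $|A|\le cB$ for an absolute constant $c$. *)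

theory Defs
  imports "HOL-Analysis.Gamma_Function" "HOL-Computational_Algebra.Primes"
begin

definition omega :: "nat \<Rightarrow> nat"
  where "omega n = card (prime_factors n)"

definition C :: "nat \<Rightarrow> real"
  where "C k = Gamma (real k + 1) / (2 powr (real k / 2) * Gamma (real k / 2 + 1))"

definition omega_moment :: "nat \<Rightarrow> real \<Rightarrow> real"
  where "omega_moment k x = (\<Sum>n | 1 \<le> n \<and> real n \<le> x. (real (omega n) - ln (ln x)) ^ k)"

end

theory Submission
  imports Defs "HOL-Number_Theory.Prime_Powers" "HOL-Computational_Algebra.Formal_Power_Series"
begin

text \<open>
  Write \<open>L = ln (ln x)\<close> and \<open>z = x powr (1 / (2 * k))\<close>. The idea is to compare the primes up to
  \<open>z\<close> that divide an integer \<open>n \<le> x\<close> with a random set \<open>S\<close> containing each prime \<open>p \<le> z\<close>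
  independently with probability \<open>1 / p\<close>, and to find the moments of the size of \<open>S\<close> from its
  generating function.

  Expanding a power of the number of primes \<open>p \<le> z\<close> dividing \<open>n\<close> over tuples of primes turns a
  moment into counts of multiples. Each such count differs from its value in the model by at most
  \<open>1\<close>, and there are at most \<open>z ^ k = sqrt x\<close> tuples of length \<open>k\<close>, so the moments of the integers
  and \<open>x\<close> times those of the model agree up to a negligible error (\<open>shifted_moment_transfer\<close>).

  The exponential generating function of the moments of \<open>card S - L\<close> is a product over primes.
  By Mertens' second theorem (\<open>mertens_second\<close>) the mean and the variance of \<open>card S\<close> are
  \<open>L + O(k)\<close>, so the product has the shape \<open>exp (L * t\<^sup>2 / 2) * H t\<close> where \<open>H\<close> is close to \<open>1\<close>.
  The coefficients of the Gaussian factor are exactly \<open>C j * sqrt L ^ j / fact j\<close> for even \<open>j\<close>,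
  and passing from index \<open>j\<close> down to index \<open>j - m\<close> costs at most a factor \<open>s ^ m\<close> with
  \<open>s = 2 * sqrt (k / L)\<close>. Hence the relative error is bounded by the sum of
  \<open>\<bar>H\<^sub>m\<bar> * s ^ m\<close> over \<open>m \<ge> 1\<close>. Together with the constant term \<open>1\<close> this sum is submultiplicative
  in \<open>H\<close>, so it can be estimated one factor at a time, and it comes out as \<open>O(k powr (3/2) / sqrt L)\<close>
  uniformly for \<open>k ^ 3 \<le> L\<close> (\<open>model_moment_estimate\<close>, \<open>truncated_moment_estimate\<close>).

  Finally an integer \<open>n \<le> x\<close> has fewer than \<open>2 * k\<close> prime factors exceeding \<open>z\<close>. Restoring them
  perturbs the \<open>k\<close>-th moment by at most \<open>2 * k\<^sup>2\<close> times an absolute moment of order \<open>k - 1\<close>, which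
  is again \<open>O(k powr (3/2) / sqrt L)\<close> relative to the main term (\<open>moment_estimate\<close>).
\<close>

section \<open>Chebyshev's bound\<close>

definition primes_upto :: "nat \<Rightarrow> nat set"
  where "primes_upto n = {p. prime p \<and> p \<le> n}"

lemma finite_primes_upto [simp]: "finite (primes_upto n)"
  unfolding primes_upto_def by (rule finite_subset[of _ "{..n}"]) auto

lemma prime_of_primes_upto: "p \<in> primes_upto n \<Longrightarrow> prime p"
  by (simp add: primes_upto_def)

lemma prod_primes_dvd_iff:
  fixes n :: nat
  assumes "finite D" "\<And>p. p \<in> D \<Longrightarrow> prime p"
  shows "\<Prod>D dvd n \<longleftrightarrow> (\<forall>p\<in>D. p dvd n)"
  using assms
proof (induction D rule: finite_induct)
  case (insert q D)
  have "coprime q (\<Prod>D)"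
    by (rule prod_coprime_right) (use insert in \<open>metis insertCI primes_coprime\<close>)
  then have "q * \<Prod>D dvd n \<longleftrightarrow> q dvd n \<and> \<Prod>D dvd n"
    by (auto intro: divides_mult dvd_mult_left dvd_mult_right)
  with insert show ?case by auto
qed auto

text \<open>
  The binomial coefficient occurs twice in the row \<open>2 * m + 1\<close> of Pascal's triangle.
\<close>

lemma odd_central_binomial_le: "(2 * m + 1 choose m) \<le> 4 ^ m"
proof -
  have "2 * (2 * m + 1 choose m) = (2 * m + 1 choose m) + (2 * m + 1 choose (m + 1))"
    using binomial_symmetric[of m "2 * m + 1"] by simp
  also have "\<dots> = (\<Sum>k\<in>{m, m + 1}. 2 * m + 1 choose k)" by simp
  also have "\<dots> \<le> (\<Sum>k\<le>2 * m + 1. 2 * m + 1 choose k)"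
    by (rule sum_mono2) auto
  also have "\<dots> = 2 * 4 ^ m"
    by (subst choose_row_sum) (simp add: power_mult)
  finally show ?thesis by simp
qed

text \<open>
  Strong induction, after Erdos: the primes \<open>p\<close> with \<open>m + 1 < p \<le> 2 * m + 1\<close> all divide
  \<open>2 * m + 1 choose m\<close>, which is at most \<open>4 ^ m\<close>, and the smaller ones contribute at most
  \<open>4 ^ (m + 1)\<close>.
\<close>

lemma prod_primes_upto_le: "\<Prod>(primes_upto n) \<le> 4 ^ n"
proof (induction n rule: less_induct)
  case (less n)
  consider "n \<le> 1" | "n = 2" | "n > 2" "even n" | "n > 2" "odd n" by linarith
  then show ?case
  proof cases
    case 1
    then have "primes_upto n = {}"
      by (auto simp: primes_upto_def dest: prime_gt_1_nat)
    then show ?thesis by simp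
  next
    case 2
    then have "primes_upto n = {2}"
      by (auto simp: primes_upto_def dest: prime_ge_2_nat)
    then show ?thesis using 2 by simp
  next
    case 3
    then have "\<not> prime n"
      by (metis prime_odd_nat)
    then have le_pred: "p \<le> n - 1" if "prime p" "p \<le> n" for p
      using that by (cases "p = n") auto
    have "primes_upto n = primes_upto (n - 1)"
      unfolding primes_upto_def using le_pred by auto
    then have "\<Prod>(primes_upto n) \<le> 4 ^ (n - 1)"
      using less.IH[of "n - 1"] 3 by simp
    also have "\<dots> \<le> 4 ^ n" by (rule power_increasing) auto
    finally show ?thesis .
  next
    case 4
    then obtain m where n: "n = 2 * m + 1" "m \<ge> 1" by (elim oddE) auto
    define B where "B = {p. prime p \<and> m + 1 < p \<and> p \<le> n}"
    have fin: "finite B" unfolding B_def by (rule finite_subset[of _ "{..n}"]) auto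
    have "primes_upto n = primes_upto (m + 1) \<union> B" "primes_upto (m + 1) \<inter> B = {}"
      using n by (auto simp: primes_upto_def B_def)
    then have split: "\<Prod>(primes_upto n) = \<Prod>(primes_upto (m + 1)) * \<Prod>B"
      using fin by (simp add: prod.union_disjoint)
    have "p dvd (n choose m)" if "p \<in> B" for p
    proof -
      have p: "prime p" "m + 1 < p" "p \<le> n" using that by (auto simp: B_def)
      have "fact m * fact (n - m) * (n choose m) = (fact n :: nat)"
        by (rule binomial_fact_lemma) (use n in auto)
      moreover have "p dvd fact n" using p by (simp add: prime_dvd_fact_iff)
      moreover have "\<not> p dvd fact m" "\<not> p dvd fact (n - m)"
        using p n by (simp_all add: prime_dvd_fact_iff del: fact_Suc)
      ultimately show ?thesis using p(1)
        by (metis prime_dvd_mult_iff)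
    qed
    then have "\<Prod>B dvd (n choose m)"
      using fin by (subst prod_primes_dvd_iff) (auto simp: B_def)
    then have "\<Prod>B \<le> (n choose m)"
      using n by (intro dvd_imp_le) (auto simp: zero_less_binomial_iff simp del: binomial_Suc_Suc)
    also have "\<dots> \<le> 4 ^ m" using odd_central_binomial_le[of m] n by simp
    finally have "\<Prod>(primes_upto n) \<le> 4 ^ (m + 1) * 4 ^ m"
      unfolding split using less.IH[of "m + 1"] n by (intro mult_mono) auto
    also have "\<dots> = 4 ^ n" using n by (simp flip: power_add)
    finally show ?thesis .
  qed
qed

lemma chebyshev_theta_le: "(\<Sum>p\<in>primes_upto n. ln (real p)) \<le> real n * ln 4"
proof -
  have "(\<Sum>p\<in>primes_upto n. ln (real p)) = ln (\<Prod>p\<in>primes_upto n. real p)"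
    by (subst ln_prod) (auto dest: prime_of_primes_upto prime_gt_0_nat)
  also have "(\<Prod>p\<in>primes_upto n. real p) = real (\<Prod>(primes_upto n))" by simp
  also have "ln \<dots> \<le> ln (real (4 ^ n))"
  proof (rule ln_mono)
    show "real (\<Prod>(primes_upto n)) \<le> real (4 ^ n)"
      using prod_primes_upto_le[of n] by (rule of_nat_mono)
    show "0 < real (\<Prod>(primes_upto n))"
      unfolding of_nat_0_less_iff
      by (rule prod_pos) (auto dest: prime_of_primes_upto prime_gt_0_nat)
  qed
  also have "\<dots> = real n * ln 4" by (simp add: ln_realpow)
  finally show ?thesis .
qed

section \<open>Mertens' theorems\<close>

lemma ln_Suc_minus_ln_le:
  assumes "n > 0"
  shows "ln (real (Suc n)) - ln (real n) \<le> 1 / real n"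
proof -
  have "ln (real (Suc n)) - ln (real n) = ln (real (Suc n) / real n)"
    using assms by (simp add: ln_divide_pos)
  also have "\<dots> = ln (1 + 1 / real n)"
    using assms by (simp add: add_divide_distrib add.commute)
  also have "\<dots> \<le> 1 / real n"
    using assms by (intro ln_add_one_self_le_self) auto
  finally show ?thesis .
qed

lemma ln_fact_ge: "real n * ln (real n) - real n \<le> ln (fact n)"
proof (induction n)
  case (Suc n)
  show ?case
  proof (cases "n = 0")
    case False
    then have "real n * (ln (real (Suc n)) - ln (real n)) \<le> 1"
      using ln_Suc_minus_ln_le[of n] by (simp add: field_simps)
    moreover have "ln (fact (Suc n) :: real) = ln (real (Suc n)) + ln (fact n)"
      by (simp add: ln_mult del: of_nat_Suc)
    ultimately show ?thesis using Suc by (simp add: algebra_simps del: of_nat_Suc)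
       (simp add: algebra_simps)
  qed auto
qed auto

lemma ln_fact_le: "ln (fact n :: real) \<le> real n * ln (real n)"
proof (cases "n = 0")
  case False
  have "(fact n :: real) \<le> real n ^ n"
    using fact_le_power[where ?'a = real, of n] by simp
  then have "ln (fact n :: real) \<le> ln (real n ^ n)"
    using False by (subst ln_le_cancel_iff) auto
  then show ?thesis using False by (simp add: ln_realpow)
qed auto

lemma card_multiples:
  assumes "d > 0"
  shows "card {m. 1 \<le> m \<and> m \<le> n \<and> d dvd m} = n div d"
proof -
  have "{m. 1 \<le> m \<and> m \<le> n \<and> d dvd m} = (\<lambda>q. d * q) ` {1..n div d}"
    using assms by (auto simp: less_eq_div_iff_mult_less_eq mult.commute elim!: dvdE
       intro!: image_eqI)
  moreover have "inj_on (\<lambda>q. d * q) {1..n div d}" using assms by (auto simp: inj_on_def)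
  ultimately show ?thesis by (simp add: card_image)
qed

text \<open>
  Legendre's formula: sum \<open>ln m = (\<Sum>d | d dvd m. mangoldt d)\<close> over \<open>m\<close> and count the multiples
  of each \<open>d\<close>.
\<close>

lemma ln_fact_eq_mangoldt_sum:
  "ln (fact n) = (\<Sum>d=1..n. mangoldt d * real (n div d))"
proof -
  have "ln (fact n :: real) = (\<Sum>m=1..n. ln (real m))"
    unfolding fact_prod of_nat_prod by (rule ln_prod) auto
  also have "\<dots> = (\<Sum>m=1..n. \<Sum>d=1..n. if d dvd m then mangoldt d else 0)"
  proof (rule sum.cong[OF refl])
    fix m assume m: "m \<in> {1..n}"
    have "ln (real m) = (\<Sum>d | d dvd m. mangoldt d)"
      using m by (subst mangoldt_sum) auto
    also have "{d. d dvd m} = {d\<in>{1..n}. d dvd m}"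
    proof -
      have "1 \<le> d \<and> d \<le> n" if "d dvd m" for d
        using that m dvd_imp_le[OF that] dvd_pos_nat[OF _ that] by simp
      then show ?thesis by auto
    qed
    finally show "ln (real m) = (\<Sum>d=1..n. if d dvd m then mangoldt d else 0)"
      by (simp only: sum.inter_filter[OF finite_atLeastAtMost])
  qed
  also have "\<dots> = (\<Sum>d=1..n. \<Sum>m=1..n. if d dvd m then mangoldt d else 0)"
    by (rule sum.swap)
  also have "\<dots> = (\<Sum>d=1..n. mangoldt d * real (n div d))"
  proof (rule sum.cong[OF refl])
    fix d assume d: "d \<in> {1..n}"
    have "(\<Sum>m=1..n. if d dvd m then mangoldt d else 0 :: real) = 
       (\<Sum>m\<in>{m\<in>{1..n}. d dvd m}. mangoldt d)"
      by (subst sum.inter_filter) auto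
    also have "\<dots> = real (card {m. 1 \<le> m \<and> m \<le> n \<and> d dvd m}) * mangoldt d"
      by (simp add: conj_assoc)
    also have "card {m. 1 \<le> m \<and> m \<le> n \<and> d dvd m} = n div d"
      by (rule card_multiples) (use d in auto)
    finally show "(\<Sum>m=1..n. if d dvd m then mangoldt d else 0) = mangoldt d * real (n div d)"
      by simp
  qed
  finally show ?thesis .
qed

lemma div_real_bounds:
  assumes "d > 0"
  shows "real (n div d) \<le> real n / real d" "real n / real d \<le> real (n div d) + 1"
proof -
  have n: "real n = real d * real (n div d) + real (n mod d)"
    by (metis mult_div_mod_eq of_nat_add of_nat_mult)
  have "real (n mod d) \<le> real d" using assms by (simp add: less_imp_le)
  with n assms show "real (n div d) \<le> real n / real d" "real n / real d \<le> real (n div d) + 1"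
    by (simp_all add: field_simps)
qed

text \<open>
  Replacing \<open>n / p\<close> by its integer part costs \<open>ln p\<close> for each prime, in total \<open>O(n)\<close> by
  Chebyshev's bound; what remains is part of Legendre's formula for \<open>ln (fact n)\<close>.
\<close>

lemma sum_ln_over_primes_le:
  assumes "n > 0"
  shows "(\<Sum>p\<in>primes_upto n. ln (real p) / real p) \<le> ln (real n) + ln 4"
proof -
  have "real n * (\<Sum>p\<in>primes_upto n. ln (real p) / real p)
      = (\<Sum>p\<in>primes_upto n. ln (real p) * (real n / real p))"
    by (simp add: sum_distrib_left mult_ac)
  also have "\<dots> \<le> (\<Sum>p\<in>primes_upto n. ln (real p) * (real (n div p) + 1))"
    by (intro sum_mono mult_left_mono div_real_bounds)
      (auto dest!: prime_of_primes_upto prime_gt_0_nat)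
  also have "\<dots> = (\<Sum>p\<in>primes_upto n. mangoldt p * real (n div p)) + (\<Sum>p\<in>primes_upto n. ln (real p))"
    by (subst sum.distrib[symmetric], rule sum.cong)
      (auto simp: algebra_simps dest!: prime_of_primes_upto)
  also have "\<dots> \<le> (\<Sum>d=1..n. mangoldt d * real (n div d)) + real n * ln 4"
    by (intro add_mono chebyshev_theta_le sum_mono2)
      (auto simp: primes_upto_def mangoldt_nonneg dest: prime_gt_0_nat)
  also have "\<dots> \<le> real n * ln (real n) + real n * ln 4"
    using ln_fact_le[of n] by (simp add: ln_fact_eq_mangoldt_sum)
  also have "\<dots> = real n * (ln (real n) + ln 4)" by (simp add: algebra_simps)
  finally show ?thesis using assms by (subst (asm) mult_le_cancel_left_pos) auto
qed

text \<open>
  The terms are dominated by the differences of \<open>(ln m + 2) / m\<close>, so that the sum telescopes.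
\<close>

lemma sum_ln_over_square_le:
  assumes "n \<ge> 1"
  shows "(\<Sum>m=2..n. ln (real m) / (real m * (real m - 1))) \<le> 2 - (ln (real n) + 2) / real n"
  using assms
proof (induction n rule: nat_induct_at_least)
  case (Suc n)
  have n: "real n > 0" using Suc by simp
  then have *: "real n * (ln (real (Suc n)) - ln (real n)) \<le> 1"
    using ln_Suc_minus_ln_le[of n] by (simp add: field_simps)
  have "ln (real (Suc n)) - ln (real n) \<le> 1 / real n"
    using n by (intro ln_Suc_minus_ln_le) simp
  also have "\<dots> \<le> 1" using Suc.hyps by simp
  finally have "ln (real (Suc n)) - ln (real n) \<le> 1" .
  with * have "ln (real (Suc n)) + 2 - (1 + real n) * (ln (real (Suc n)) - ln (real n)) \<ge> ln (real (Suc n))"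
    by (simp add: algebra_simps del: of_nat_Suc)
  then have "ln (real (Suc n)) / (real (Suc n) * real n)
    \<le> (ln (real (Suc n)) + 2 - (1 + real n) * (ln (real (Suc n)) - ln (real n))) / (real (Suc n) * real n)"
    using n by (intro divide_right_mono) auto
  also have "\<dots> = (ln (real n) + 2) / real n - (ln (real (Suc n)) + 2) / real (Suc n)"
    using n by (simp add: divide_simps) (simp add: algebra_simps)
  finally have "ln (real (Suc n)) / (real (Suc n) * real n)
      \<le> (ln (real n) + 2) / real n - (ln (real (Suc n)) + 2) / real (Suc n)" .
  moreover have "(\<Sum>m=2..Suc n. ln (real m) / (real m * (real m - 1)))
     = (\<Sum>m=2..n. ln (real m) / (real m * (real m - 1))) + ln (real (Suc n)) / (real (Suc n) * real n)"
    using Suc.hyps by (subst sum.nat_ivl_Suc') auto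
  ultimately show ?case using Suc.IH by linarith
qed auto

lemma sum_over_primes_le_sum_from_2:
  assumes "\<And>m. m \<ge> 2 \<Longrightarrow> f m \<ge> (0::real)"
  shows "sum f (primes_upto n) \<le> sum f {2..n}"
  using assms by (intro sum_mono2) (auto simp: primes_upto_def dest: prime_ge_2_nat)

lemma sum_power_inverse_le:
  assumes "p \<ge> (2::real)"
  shows "(\<Sum>i=1..n. 1 / p ^ i) \<le> 1 / p + 1 / (p * (p - 1))"
proof -
  have "(p - 1) * (\<Sum>i=1..n. 1 / p ^ i) = 1 - 1 / p ^ n"
  proof (induction n)
    case (Suc n)
    have "(p - 1) * (\<Sum>i=1..Suc n. 1 / p ^ i) = (p - 1) * (\<Sum>i=1..n. 1 / p ^ i) + (p - 1) * (1 / p ^ Suc n)"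
      by (simp add: distrib_left)
    also have "\<dots> = 1 - 1 / p ^ Suc n"
      unfolding Suc.IH using assms by (simp add: field_simps)
    finally show ?case .
  qed simp
  then have "(\<Sum>i=1..n. 1 / p ^ i) = (1 - 1 / p ^ n) / (p - 1)"
    using assms by (simp add: field_simps)
  also have "\<dots> \<le> 1 / (p - 1)" using assms by (intro divide_right_mono) auto
  also have "\<dots> = 1 / p + 1 / (p * (p - 1))" using assms by (simp add: field_simps)
  finally show ?thesis .
qed

text \<open>
  Legendre's formula gives the lower bound for the sum over all prime powers. The proper prime
  powers contribute at most the convergent sum of \<open>ln p / (p * (p - 1))\<close>.
\<close>

lemma sum_ln_over_primes_ge:
  assumes "n > 0"
  shows "(\<Sum>p\<in>primes_upto n. ln (real p) / real p) \<ge> ln (real n) - 3"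
proof -
  have "real n * (ln (real n) - 1) \<le> (\<Sum>d=1..n. mangoldt d * real (n div d))"
    using ln_fact_ge[of n] by (simp add: ln_fact_eq_mangoldt_sum algebra_simps)
  also have "\<dots> \<le> (\<Sum>d=1..n. mangoldt d * (real n / real d))"
    by (intro sum_mono mult_left_mono div_real_bounds mangoldt_nonneg) auto
  also have "\<dots> = real n * (\<Sum>d=1..n. mangoldt d / real d)"
    by (simp add: sum_distrib_left mult_ac)
  finally have "ln (real n) - 1 \<le> (\<Sum>d=1..n. mangoldt d / real d)"
    using assms by (subst (asm) mult_le_cancel_left_pos) auto
  also have "\<dots> = (\<Sum>d\<in>{d\<in>{1..n}. primepow d}. mangoldt d / real d)"
    by (rule sum.mono_neutral_right) (auto simp: mangoldt_def)
  also have "\<dots> \<le> (\<Sum>d\<in>(\<lambda>(p,i). p ^ i) ` (primes_upto n \<times> {1..n}). mangoldt d / real d)"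
  proof (rule sum_mono2)
    show "{d \<in> {1..n}. primepow d} \<subseteq> (\<lambda>(p,i). p ^ i) ` (primes_upto n \<times> {1..n})"
    proof
      fix d assume d: "d \<in> {d \<in> {1..n}. primepow d}"
      then obtain p i where pi: "prime p" "i > 0" "d = p ^ i" by (auto simp: primepow_def)
      have "p \<ge> 2" using pi prime_ge_2_nat by auto
      then have "i < p ^ i" by (intro power_gt_expt) auto
      moreover have "p \<le> p ^ i" using pi \<open>p \<ge> 2\<close> by (intro self_le_power) auto
      ultimately show "d \<in> (\<lambda>(p,i). p ^ i) ` (primes_upto n \<times> {1..n})"
        using d pi by (intro image_eqI[of _ _ "(p, i)"]) (auto simp: primes_upto_def)
    qed
  qed (auto simp: mangoldt_nonneg)
  also have "\<dots> = (\<Sum>(p,i)\<in>primes_upto n \<times> {1..n}. mangoldt (p ^ i) / real (p ^ i))"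
  proof (subst sum.reindex)
    show "inj_on (\<lambda>(p,i). p ^ i) (primes_upto n \<times> {1..n})"
      by (auto simp: inj_on_def primes_upto_def prime_power_inj'' )
  qed (simp_all add: case_prod_unfold o_def)
  also have "\<dots> = (\<Sum>p\<in>primes_upto n. \<Sum>i=1..n. mangoldt (p ^ i) / real (p ^ i))"
    by (rule sum.cartesian_product[symmetric])
  also have "\<dots> = (\<Sum>p\<in>primes_upto n. ln (real p) * (\<Sum>i=1..n. 1 / real p ^ i))"
    by (subst sum_distrib_left) (intro sum.cong refl, auto dest!: prime_of_primes_upto)
  also have "\<dots> \<le> (\<Sum>p\<in>primes_upto n. ln (real p) * (1 / real p + 1 / (real p * (real p - 1))))"
    by (intro sum_mono mult_left_mono sum_power_inverse_le)
      (auto dest!: prime_of_primes_upto prime_ge_2_nat)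
  also have "\<dots> = (\<Sum>p\<in>primes_upto n. ln (real p) / real p)
      + (\<Sum>p\<in>primes_upto n. ln (real p) / (real p * (real p - 1)))"
    by (simp add: sum.distrib[symmetric] ring_distribs)
  also have "(\<Sum>p\<in>primes_upto n. ln (real p) / (real p * (real p - 1)))
     \<le> (\<Sum>m=2..n. ln (real m) / (real m * (real m - 1)))"
    by (rule sum_over_primes_le_sum_from_2) auto
  also have "\<dots> \<le> 2 - (ln (real n) + 2) / real n"
    using assms by (intro sum_ln_over_square_le) auto
  also have "\<dots> \<le> 2" using assms by simp
  finally show ?thesis by simp
qed

text \<open>
  Summation by parts in the form that carries Mertens' first theorem over to the second: \<open>b\<close> will
  be \<open>1 / ln m\<close> and \<open>R\<close> the bounded error term. The induction keeps the boundary term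
  \<open>b n * R n\<close> apart, whence the stronger bound \<open>c * (2 * b 2 - b n)\<close>.
\<close>

lemma abel_summation_bound:
  fixes b R :: "nat \<Rightarrow> real"
  assumes R: "\<And>m. m \<ge> 1 \<Longrightarrow> \<bar>R m\<bar> \<le> c"
    and b: "\<And>m. m \<ge> 2 \<Longrightarrow> b m \<ge> 0" "\<And>m. m \<ge> 2 \<Longrightarrow> b (Suc m) \<le> b m"
    and n: "n \<ge> 2"
  shows "\<bar>\<Sum>m=2..n. b m * (R m - R (m - 1))\<bar> \<le> 2 * c * b 2"
proof -
  have "\<bar>(\<Sum>m=2..n. b m * (R m - R (m - 1))) - b n * R n\<bar> \<le> c * (2 * b 2 - b n)"
    using n
  proof (induction n rule: nat_induct_at_least)
    case base
    have "\<bar>b 2 * (R 2 - R 1) - b 2 * R 2\<bar> = b 2 * \<bar>R 1\<bar>"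
      using b(1)[of 2] by (simp add: algebra_simps abs_mult)
    also have "\<dots> \<le> b 2 * c" using R[of 1] b(1)[of 2] by (intro mult_left_mono) auto
    finally show ?case by (simp add: algebra_simps)
  next
    case (Suc n)
    define S where "S = (\<Sum>m=2..n. b m * (R m - R (m - 1)))"
    have "(\<Sum>m=2..Suc n. b m * (R m - R (m - 1))) - b (Suc n) * R (Suc n)
        = (S - b n * R n) + (b n - b (Suc n)) * R n"
      using Suc.hyps by (simp add: S_def algebra_simps)
    also have "\<bar>\<dots>\<bar> \<le> \<bar>S - b n * R n\<bar> + \<bar>(b n - b (Suc n)) * R n\<bar>"
      by (rule abs_triangle_ineq)
    also have "\<bar>(b n - b (Suc n)) * R n\<bar> \<le> (b n - b (Suc n)) * c"
      using Suc.hyps R[of n] b(2)[of n] by (simp add: abs_mult mult_left_mono)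
    also have "\<bar>S - b n * R n\<bar> \<le> c * (2 * b 2 - b n)" using Suc.IH by (simp add: S_def)
    finally show ?case by (simp add: algebra_simps)
  qed
  moreover have "\<bar>b n * R n\<bar> \<le> b n * c"
    using R[of n] b(1)[of n] n by (simp add: abs_mult mult_left_mono)
  ultimately show ?thesis by (simp add: algebra_simps)
qed

text \<open>
  Put \<open>u = ln n\<close> and \<open>v = ln (n + 1)\<close>. Then \<open>(v - u) / v \<le> ln v - ln u \<le> (v - u) / u\<close>, and the
  two bounds differ by at most \<open>1 / u - 1 / v\<close> because \<open>v - u \<le> 1\<close>. Hence the excess of
  \<open>ln (ln n)\<close> over the sum is increasing in \<open>n\<close>, but becomes decreasing after adding \<open>1 / ln n\<close>.
\<close>

lemma ln_ln_approx_sum: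
  "\<exists>c. \<forall>n\<ge>2. \<bar>(\<Sum>m=2..n. (ln (real m) - ln (real (m - 1))) / ln (real m)) - ln (ln (real n))\<bar> \<le> c"
proof -
  define f where "f n = ln (ln (real n)) - (\<Sum>m=2..n. (ln (real m) - ln (real (m - 1))) / ln (real m))" for n
  have step: "f n \<le> f (Suc n)" "f (Suc n) + 1 / ln (real (Suc n)) \<le> f n + 1 / ln (real n)"
    if "n \<ge> 2" for n
  proof -
    define u v where "u = ln (real n)" and "v = ln (real (Suc n))"
    have uv: "0 < u" "u \<le> v" using that by (auto simp: u_def v_def)
    have "v - u \<le> 1 / real n" unfolding u_def v_def using that by (intro ln_Suc_minus_ln_le) auto
    also have "\<dots> \<le> 1" using that by simp
    finally have "v - u \<le> 1" .
    have diff: "f (Suc n) - f n = ln v - ln u - (v - u) / v"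
      using that by (simp add: f_def u_def v_def)
    have "ln (u / v) \<le> u / v - 1" using uv by (intro ln_le_minus_one) auto
    then show "f n \<le> f (Suc n)"
      using uv diff by (simp add: ln_divide_pos diff_divide_distrib)
    have "ln (v / u) \<le> v / u - 1" using uv by (intro ln_le_minus_one) auto
    then have "f (Suc n) - f n \<le> (v - u) / u - (v - u) / v"
      using uv diff by (simp add: ln_divide_pos diff_divide_distrib)
    also have "\<dots> = (v - u) * (1 / u - 1 / v)" by (simp add: algebra_simps)
    also have "\<dots> \<le> 1 * (1 / u - 1 / v)"
      using uv \<open>v - u \<le> 1\<close> by (intro mult_right_mono) (auto simp: frac_le)
    finally show "f (Suc n) + 1 / ln (real (Suc n)) \<le> f n + 1 / ln (real n)"
      by (simp add: u_def v_def)
  qed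
  have bounds: "f 2 \<le> f n \<and> f n + 1 / ln (real n) \<le> f 2 + 1 / ln 2" if "n \<ge> 2" for n
    using that
  proof (induction n rule: nat_induct_at_least)
    case (Suc n)
    with step[of n] show ?case by linarith
  qed simp
  have "\<bar>f n\<bar> \<le> \<bar>f 2\<bar> + 1 / ln 2" if "n \<ge> 2" for n
  proof -
    have "1 / ln (real n) \<ge> 0" using that by simp
    moreover have "1 / ln (2::real) \<ge> 0" by simp
    ultimately show ?thesis using bounds[OF that] by linarith
  qed
  then show ?thesis unfolding f_def by (intro exI[of _ "\<bar>f 2\<bar> + 1 / ln 2"]) (simp add: abs_minus_commute f_def)
qed

text \<open>
  By Mertens' first theorem, \<open>ln p / p\<close> summed over \<open>p \<le> n\<close> is \<open>ln n + R n\<close> with \<open>\<bar>R n\<bar> \<le> 3\<close>.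
  Dividing the increments by \<open>ln m\<close>, the main term becomes the sum in \<open>ln_ln_approx_sum\<close> and the
  error is controlled by partial summation.
\<close>

theorem mertens_second:
  "\<exists>c>0. \<forall>n\<ge>2. \<bar>(\<Sum>p\<in>primes_upto n. 1 / real p) - ln (ln (real n))\<bar> \<le> c"
proof -
  obtain c1 where c1: "\<And>n. n \<ge> 2 \<Longrightarrow>
      \<bar>(\<Sum>m=2..n. (ln (real m) - ln (real (m - 1))) / ln (real m)) - ln (ln (real n))\<bar> \<le> c1"
    using ln_ln_approx_sum by blast
  define R where "R n = (\<Sum>p\<in>primes_upto n. ln (real p) / real p) - ln (real n)" for n
  have "ln (4::real) \<le> 3" using ln_le_minus_one[of 4] by simp
  then have R: "\<bar>R n\<bar> \<le> 3" if "n \<ge> 1" for n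
    using sum_ln_over_primes_le[of n] sum_ln_over_primes_ge[of n] that by (simp add: R_def)
  have "\<bar>(\<Sum>p\<in>primes_upto n. 1 / real p) - ln (ln (real n))\<bar> \<le> 6 / ln 2 + c1" if "n \<ge> 2" for n
  proof -
    have upto_diff: "primes_upto m = primes_upto (m - 1) \<union> (if prime m then {m} else {})" for m
      by (cases m) (auto simp: primes_upto_def le_Suc_eq)
    have R_diff: "R m - R (m - 1) = (if prime m then ln (real m) / real m else 0) - (ln (real m) - ln (real (m - 1)))"
      if "m \<ge> 2" for m
    proof -
      have "m \<notin> primes_upto (m - 1)" using that unfolding primes_upto_def by auto
      then have "(\<Sum>p\<in>primes_upto m. ln (real p) / real p) =
          (\<Sum>p\<in>primes_upto (m - 1). ln (real p) / real p) + (if prime m then ln (real m) / real m else 0)"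
        unfolding upto_diff[of m] by (cases "prime m") simp_all
      then show ?thesis unfolding R_def by simp
    qed
    have "primes_upto n = {m\<in>{2..n}. prime m}"
      by (auto simp: primes_upto_def dest: prime_ge_2_nat)
    then have "(\<Sum>p\<in>primes_upto n. 1 / real p) = (\<Sum>m=2..n. if prime m then 1 / real m else 0)"
      by (simp only: sum.inter_filter[OF finite_atLeastAtMost])
    also have "\<dots> = (\<Sum>m=2..n. 1 / ln (real m) * (R m - R (m - 1)) + (ln (real m) - ln (real (m - 1))) / ln (real m))"
    proof (rule sum.cong[OF refl])
      fix m assume m: "m \<in> {2..n}"
      then have ln: "ln (real m) > 0" by simp
      have "R m - R (m - 1) = (if prime m then ln (real m) / real m else 0) - (ln (real m) - ln (real (m - 1)))"
        using m by (intro R_diff) auto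
      then have "1 / ln (real m) * (R m - R (m - 1)) = (if prime m then 1 / real m else 0)
          - (ln (real m) - ln (real (m - 1))) / ln (real m)"
        using ln by (simp add: diff_divide_distrib)
      then show "(if prime m then 1 / real m else 0) =
          1 / ln (real m) * (R m - R (m - 1)) + (ln (real m) - ln (real (m - 1))) / ln (real m)"
        by simp
    qed
    also have "\<dots> = (\<Sum>m=2..n. 1 / ln (real m) * (R m - R (m - 1)))
        + (\<Sum>m=2..n. (ln (real m) - ln (real (m - 1))) / ln (real m))" (is "_ = ?X + ?Y")
      by (rule sum.distrib)
    finally have eq: "(\<Sum>p\<in>primes_upto n. 1 / real p) = ?X + ?Y" .
    have "\<bar>?X\<bar> \<le> 2 * 3 * (1 / ln (real 2))"
      by (rule abel_summation_bound) (use R that in \<open>simp_all add: frac_le\<close>)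
    with c1[OF that] show ?thesis unfolding eq by simp
  qed
  then show ?thesis
    by (intro exI[of _ "max 1 (6 / ln 2 + c1)"]) (auto simp: le_max_iff_disj)
qed

lemma sum_inverse_squares_primes_le:
  "(\<Sum>p\<in>primes_upto n. 1 / real p ^ 2) \<le> 1"
proof -
  have "(\<Sum>p\<in>primes_upto n. 1 / real p ^ 2) \<le> (\<Sum>m=2..n. 1 / real m ^ 2)"
    by (rule sum_over_primes_le_sum_from_2) auto
  also have "\<dots> \<le> 1"
  proof (cases "n \<ge> 1")
    case True
    then have "(\<Sum>m=2..n. 1 / real m ^ 2) \<le> 1 - 1 / real n"
    proof (induction n rule: nat_induct_at_least)
      case (Suc n)
      have "1 / real (Suc n) ^ 2 \<le> 1 / real n - 1 / real (Suc n)"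
        using Suc.hyps by (simp add: divide_simps) (simp add: algebra_simps power2_eq_square)
      moreover have "(\<Sum>m=2..Suc n. 1 / real m ^ 2) = (\<Sum>m=2..n. 1 / real m ^ 2) + 1 / real (Suc n) ^ 2"
        using Suc.hyps by (subst sum.nat_ivl_Suc') auto
      ultimately show ?case using Suc.IH by linarith
    qed auto
    also have "\<dots> \<le> 1" by simp
    finally show ?thesis .
  qed auto
  finally show ?thesis .
qed

section \<open>The constants \<open>C k\<close>\<close>

lemma C_0 [simp]: "C 0 = 1"
  by (simp add: C_def)

lemma C_1: "C (Suc 0) = 2 / sqrt (2 * pi)"
proof -
  have "(1 / 2 :: real) \<notin> \<int>\<^sub>\<le>\<^sub>0" by (auto elim!: nonpos_Ints_cases')
  from Gamma_plus1[OF this] have Gamma_three_halves: "Gamma (3 / 2 :: real) = sqrt pi / 2"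
    by (simp add: Gamma_one_half_real)
  have "Gamma (2 :: real) = 1"
    using Gamma_fact[of 1, where ?'a = real] by simp
  then have "C (Suc 0) = 1 / (sqrt 2 * Gamma (3 / 2))"
    by (simp add: C_def powr_half_sqrt)
  then show ?thesis unfolding Gamma_three_halves by (simp add: real_sqrt_mult)
qed

text \<open>
  This recurrence, with the values at \<open>0\<close> and \<open>1\<close>, determines \<open>C\<close>; for even \<open>k\<close> it yields the
  product of the odd numbers below \<open>k\<close>, the \<open>k\<close>-th moment of a standard Gaussian variable.
\<close>

lemma C_Suc_Suc: "C (Suc (Suc j)) = (real j + 1) * C j"
proof -
  have pos: "x \<notin> \<int>\<^sub>\<le>\<^sub>0" if "x > 0" for x :: real
    using that by (auto elim!: nonpos_Ints_cases')
  have "Gamma (real j + 3) = (real j + 2) * ((real j + 1) * Gamma (real j + 1))"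
    using Gamma_plus1[of "real j + 2"] Gamma_plus1[of "real j + 1"] pos[of "real j + 2"] pos[of "real j + 1"]
    by (simp add: add_ac)
  moreover have "Gamma (real j / 2 + 2) = (real j / 2 + 1) * Gamma (real j / 2 + 1)"
    using Gamma_plus1[of "real j / 2 + 1"] pos[of "real j / 2 + 1"] by (simp add: add_ac)
  moreover have "2 powr (real j / 2 + 1) = 2 * 2 powr (real j / 2)"
    by (simp add: powr_add)
  moreover have "real (Suc (Suc j)) / 2 = real j / 2 + 1" "real (Suc (Suc j)) + 1 = real j + 3"
     "real j / 2 + 1 + 1 = real j / 2 + 2"
    by simp_all
  ultimately have "C (Suc (Suc j)) = (real j + 2) * ((real j + 1) * Gamma (real j + 1))
      / (2 * 2 powr (real j / 2) * ((real j / 2 + 1) * Gamma (real j / 2 + 1)))"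
    unfolding C_def by (simp only:)
  also have "2 * 2 powr (real j / 2) * ((real j / 2 + 1) * Gamma (real j / 2 + 1))
      = (real j + 2) * (2 powr (real j / 2) * Gamma (real j / 2 + 1))"
    by (simp add: algebra_simps)
  finally show ?thesis by (simp add: C_def)
qed

lemma C_ge_half: "C j \<ge> 1 / 2"
proof (induction j rule: induct_nat_012)
  case 1
  have "sqrt (2 * pi) \<le> sqrt (4\<^sup>2)"
    using pi_less_4 by (intro real_sqrt_le_mono) simp
  then show ?case by (simp add: C_1 field_simps)
next
  case (ge2 j)
  have "1 * (1 / 2) \<le> (real j + 1) * C j" using ge2 by (intro mult_mono) auto
  then show ?case by (simp add: C_Suc_Suc)
qed simp

lemma C_pos: "C j > 0"
  using C_ge_half[of j] by linarith

text \<open>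
  The ratio \<open>C (j + 1) / C j\<close> grows like \<open>sqrt j\<close>. Raising \<open>j\<close> by \<open>2\<close> multiplies it by
  \<open>(j + 2) / (j + 1)\<close>, whereas \<open>sqrt (j + 1)\<close> is multiplied by \<open>sqrt ((j + 3) / (j + 1))\<close>, which
  is smaller since \<open>(j + 1) * (j + 3) \<le> (j + 2)\<^sup>2\<close>.
\<close>

lemma sqrt_times_C_le: "sqrt (real (Suc j)) * C j \<le> 2 * C (Suc j)"
proof (induction j rule: induct_nat_012)
  case 0
  show ?case using C_ge_half[of 1] by simp
next
  case 1
  have "sqrt (2\<^sup>2) \<le> sqrt (2 * pi)" using pi_gt3 by (intro real_sqrt_le_mono) simp
  then have "C 1 \<le> 1" by (simp add: C_1)
  moreover have "sqrt 2 \<le> sqrt (2\<^sup>2)" by (intro real_sqrt_le_mono) simp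
  ultimately have "sqrt 2 * C 1 \<le> 2 * 1" using C_pos[of 1] by (intro mult_mono) auto
  then show ?case by (simp add: C_Suc_Suc)
next
  case (ge2 j)
  have "sqrt (real j + 3) * sqrt (real j + 1) = sqrt ((real j + 3) * (real j + 1))"
    by (simp add: real_sqrt_mult)
  also have "\<dots> \<le> sqrt ((real j + 2)\<^sup>2)"
    by (intro real_sqrt_le_mono) (simp add: power2_eq_square algebra_simps)
  finally have *: "sqrt (real j + 3) * sqrt (real j + 1) \<le> real j + 2" by simp
  have "sqrt (real (Suc (Suc (Suc j)))) * C (Suc (Suc j))
      = (sqrt (real j + 3) * sqrt (real j + 1)) * (sqrt (real j + 1) * C j)"
    by (simp add: C_Suc_Suc add_ac)
  also have "\<dots> \<le> (real j + 2) * (2 * C (Suc j))"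
  proof (rule mult_mono[OF *])
    show "sqrt (real j + 1) * C j \<le> 2 * C (Suc j)" using ge2(1) by (simp add: add_ac)
  qed (use C_pos[of j] in auto)
  also have "\<dots> = 2 * C (Suc (Suc (Suc j)))" by (simp add: C_Suc_Suc add_ac)
  finally show ?case .
qed

lemma C_even: "C (2 * i) = fact (2 * i) / (2 ^ i * fact i)"
  using Gamma_fact[of "2 * i", where ?'a = real] Gamma_fact[of i, where ?'a = real]
  by (simp add: C_def powr_realpow add.commute)

text \<open>
  For even \<open>j\<close> this is the coefficient of \<open>t ^ j\<close> in \<open>exp (\<sigma>\<^sup>2 * t\<^sup>2 / 2)\<close>. The definition of \<open>C\<close>
  through the Gamma function interpolates it to odd \<open>j\<close>, where it serves as the scale of the
  error term.
\<close>

definition gauss_coeff :: "real \<Rightarrow> nat \<Rightarrow> real"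
  where "gauss_coeff \<sigma> j = C j * \<sigma> ^ j / fact j"

lemma gauss_coeff_pos: "\<sigma> > 0 \<Longrightarrow> gauss_coeff \<sigma> j > 0"
  by (simp add: gauss_coeff_def C_pos)

text \<open>
  What each power of \<open>t\<close> taken from the perturbing factor costs: lowering the index by one
  multiplies the coefficient by at most \<open>2 * sqrt k / \<sigma>\<close>. This is the radius at which the
  perturbation will be measured.
\<close>

lemma gauss_coeff_le_shift:
  assumes "\<sigma> > 0" "i \<le> j" "j \<le> k"
  shows "gauss_coeff \<sigma> i \<le> (2 * sqrt (real k) / \<sigma>) ^ (j - i) * gauss_coeff \<sigma> j"
  using assms(2,3)
proof (induction j rule: dec_induct)
  case (step j)
  define r where "r = sqrt (real (Suc j))"
  have r: "r > 0" "r ^ 2 = real (Suc j)" by (simp_all add: r_def)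
  have "gauss_coeff \<sigma> j \<le> (2 * r / \<sigma>) * gauss_coeff \<sigma> (Suc j)"
  proof -
    have "C j * real (Suc j) = r * (r * C j)" using r(2) by (simp add: power2_eq_square)
    also have "\<dots> \<le> r * (2 * C (Suc j))"
      using sqrt_times_C_le[of j] r(1) unfolding r_def by (intro mult_left_mono) auto
    finally have "C j * real (Suc j) \<le> 2 * r * C (Suc j)" by simp
    then have "C j * real (Suc j) * (\<sigma> ^ j / fact (Suc j)) \<le> 2 * r * C (Suc j) * (\<sigma> ^ j / fact (Suc j))"
      using assms(1) by (intro mult_right_mono) auto
    then show ?thesis using assms(1) 
      by (simp add: gauss_coeff_def divide_simps del: of_nat_Suc)
  qed
  also have "\<dots> \<le> (2 * sqrt (real k) / \<sigma>) * gauss_coeff \<sigma> (Suc j)"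
    using step.prems gauss_coeff_pos[OF assms(1)] assms(1)
    by (intro mult_right_mono divide_right_mono) (auto simp: r_def less_imp_le)
  finally have *: "gauss_coeff \<sigma> j \<le> (2 * sqrt (real k) / \<sigma>) * gauss_coeff \<sigma> (Suc j)" .
  have "gauss_coeff \<sigma> i \<le> (2 * sqrt (real k) / \<sigma>) ^ (j - i) * gauss_coeff \<sigma> j"
    using step by simp
  also have "\<dots> \<le> (2 * sqrt (real k) / \<sigma>) ^ (j - i) * ((2 * sqrt (real k) / \<sigma>) * gauss_coeff \<sigma> (Suc j))"
    using assms(1) by (intro mult_left_mono *) auto
  also have "\<dots> = (2 * sqrt (real k) / \<sigma>) ^ (Suc j - i) * gauss_coeff \<sigma> (Suc j)"
    using step.hyps by (simp add: Suc_diff_le mult_ac)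
  finally show ?case .
qed simp

section \<open>A majorant norm for formal power series\<close>

text \<open>
  Majorant norm: the sum of the absolute values of the terms at radius \<open>s\<close>. Truncation at degree
  \<open>k\<close> keeps it a finite sum for every series without destroying submultiplicativity, and a moment
  of order at most \<open>k\<close> involves no higher coefficients.
\<close>

definition coeff_norm :: "nat \<Rightarrow> real \<Rightarrow> real fps \<Rightarrow> real"
  where "coeff_norm k s f = (\<Sum>n\<le>k. \<bar>fps_nth f n\<bar> * s ^ n)"

lemma coeff_norm_nonneg: "s \<ge> 0 \<Longrightarrow> coeff_norm k s f \<ge> 0"
  by (simp add: coeff_norm_def sum_nonneg)

lemma coeff_norm_one [simp]: "coeff_norm k s 1 = 1"
  by (simp add: coeff_norm_def if_distrib if_distribR cong: if_cong)

lemma coeff_norm_add_le: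
  assumes "s \<ge> 0"
  shows "coeff_norm k s (f + g) \<le> coeff_norm k s f + coeff_norm k s g"
  unfolding coeff_norm_def sum.distrib[symmetric] distrib_right[symmetric]
  using assms by (intro sum_mono mult_right_mono) auto

lemma coeff_norm_minus_one:
  assumes "fps_nth f 0 = 1"
  shows "coeff_norm k s (f - 1) = coeff_norm k s f - 1"
proof -
  have "\<bar>fps_nth (f - 1) n\<bar> * s ^ n = \<bar>fps_nth f n\<bar> * s ^ n - (if n = 0 then 1 else 0)" for n
    using assms by auto
  then show ?thesis by (simp add: coeff_norm_def sum_subtractf)
qed

lemma coeff_norm_mult_le:
  assumes "s \<ge> 0"
  shows "coeff_norm k s (f * g) \<le> coeff_norm k s f * coeff_norm k s g"
proof -
  define F G where "F i = \<bar>fps_nth f i\<bar> * s ^ i" and "G i = \<bar>fps_nth g i\<bar> * s ^ i" for i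
  have nonneg: "F i \<ge> 0" "G i \<ge> 0" for i using assms by (simp_all add: F_def G_def)
  have "coeff_norm k s (f * g) \<le> (\<Sum>n\<le>k. \<Sum>i\<le>n. F i * G (n - i))"
    unfolding coeff_norm_def
  proof (rule sum_mono)
    fix n
    have "\<bar>fps_nth (f * g) n\<bar> \<le> (\<Sum>i\<le>n. \<bar>fps_nth f i * fps_nth g (n - i)\<bar>)"
      unfolding fps_mult_nth atLeast0AtMost by (rule sum_abs)
    then have "\<bar>fps_nth (f * g) n\<bar> * s ^ n \<le> (\<Sum>i\<le>n. \<bar>fps_nth f i * fps_nth g (n - i)\<bar>) * s ^ n"
      using assms by (intro mult_right_mono) auto
    also have "\<dots> = (\<Sum>i\<le>n. F i * G (n - i))"
      unfolding sum_distrib_right F_def G_def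
    proof (intro sum.cong refl)
      fix i assume "i \<in> {..n}"
      then have "s ^ n = s ^ i * s ^ (n - i)" by (simp flip: power_add)
      then show "\<bar>fps_nth f i * fps_nth g (n - i)\<bar> * s ^ n =
        \<bar>fps_nth f i\<bar> * s ^ i * (\<bar>fps_nth g (n - i)\<bar> * s ^ (n - i))"
        by (simp add: abs_mult)
    qed
    finally show "\<bar>fps_nth (f * g) n\<bar> * s ^ n \<le> (\<Sum>i\<le>n. F i * G (n - i))" .
  qed
  also have "\<dots> = (\<Sum>(i,j)\<in>{(i,j). i + j \<le> k}. F i * G j)"
    by (rule sum.triangle_reindex_eq[symmetric])
  also have "\<dots> \<le> (\<Sum>(i,j)\<in>{..k} \<times> {..k}. F i * G j)"
    by (rule sum_mono2) (auto simp: nonneg)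
  also have "\<dots> = coeff_norm k s f * coeff_norm k s g"
    by (simp add: coeff_norm_def F_def G_def sum_product sum.cartesian_product)
  finally show ?thesis .
qed

lemma coeff_norm_prod_le:
  assumes "s \<ge> 0"
  shows "coeff_norm k s (\<Prod>i\<in>A. f i) \<le> (\<Prod>i\<in>A. coeff_norm k s (f i))"
proof (induction A rule: infinite_finite_induct)
  case (insert i A)
  have "coeff_norm k s (\<Prod>i\<in>insert i A. f i) \<le> coeff_norm k s (f i) * coeff_norm k s (\<Prod>i\<in>A. f i)"
    using insert.hyps coeff_norm_mult_le[OF assms] by simp
  also have "\<dots> \<le> coeff_norm k s (f i) * (\<Prod>i\<in>A. coeff_norm k s (f i))"
    by (intro mult_left_mono insert.IH coeff_norm_nonneg assms)
  finally show ?case using insert.hyps by simp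
qed simp_all

text \<open>
  Since \<open>fact n \<ge> fact (n - r)\<close>, a factor \<open>x ^ r\<close> can be taken out of the tail that starts at
  \<open>r\<close>.
\<close>

lemma exp_series_segment_le:
  assumes "x \<ge> (0::real)"
  shows "(\<Sum>n\<in>{r..k}. x ^ n / fact n) \<le> x ^ r * exp x"
proof -
  have "(\<Sum>n\<in>{r..k}. x ^ n / fact n) \<le> (\<Sum>n\<in>{r..k}. x ^ r * (x ^ (n - r) / fact (n - r)))"
  proof (rule sum_mono)
    fix n assume n: "n \<in> {r..k}"
    have "x ^ n / fact n \<le> x ^ n / fact (n - r)"
      using assms by (intro divide_left_mono fact_mono) auto
    also have "\<dots> = x ^ r * (x ^ (n - r) / fact (n - r))" using n by (simp flip: power_add)
    finally show "x ^ n / fact n \<le> x ^ r * (x ^ (n - r) / fact (n - r))" .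
  qed
  also have "\<dots> = x ^ r * (\<Sum>n\<in>{r..k}. x ^ (n - r) / fact (n - r))"
    by (simp add: sum_distrib_left)
  also have "(\<Sum>n\<in>{r..k}. x ^ (n - r) / fact (n - r)) = (\<Sum>n\<in>(\<lambda>n. n - r) ` {r..k}. x ^ n / fact n)"
    by (subst sum.reindex) (auto simp: inj_on_def)
  also have "\<dots> \<le> (\<Sum>n. x ^ n / fact n)"
    using assms summable_exp[of x] by (intro sum_le_suminf) (auto simp: field_simps)
  also have "\<dots> = exp x" by (simp add: exp_def divide_inverse scaleR_conv_of_real mult.commute)
  finally show ?thesis using assms by (simp add: mult_left_mono)
qed

lemma coeff_norm_fps_exp_le:
  assumes "s \<ge> 0"
  shows "coeff_norm k s (fps_exp a) \<le> exp (\<bar>a\<bar> * s)"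
  using exp_series_segment_le[of "\<bar>a\<bar> * s" 0 k] assms
  by (simp add: coeff_norm_def power_abs power_mult_distrib atLeast0AtMost)

definition gauss_fps :: "real \<Rightarrow> real fps"
  where "gauss_fps a = fps_exp a oo fps_X ^ 2"

lemma gauss_fps_nth: "fps_nth (gauss_fps a) n = (if even n then a ^ (n div 2) / fact (n div 2) else 0)"
proof -
  have "fps_nth (gauss_fps a) n = (\<Sum>i=0..n. if n = 2 * i then a ^ i / fact i else 0)"
    unfolding gauss_fps_def fps_compose_nth
    by (intro sum.cong refl) (simp add: fps_X_power_nth flip: power_mult)
  also have "\<dots> = (\<Sum>i\<in>(if even n then {n div 2} else {}). a ^ i / fact i)"
    by (intro sum.mono_neutral_cong_right) (auto split: if_splits)
  finally show ?thesis by simp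
qed

lemma gauss_fps_add: "gauss_fps (a + b) = gauss_fps a * gauss_fps b"
  by (simp add: gauss_fps_def fps_exp_add_mult fps_compose_mult_distrib)

lemma gauss_fps_sum: "gauss_fps (\<Sum>i\<in>A. f i) = (\<Prod>i\<in>A. gauss_fps (f i))"
proof (induction A rule: infinite_finite_induct)
  case empty
  then show ?case by (simp add: gauss_fps_def)
qed (simp_all add: gauss_fps_add, simp add: gauss_fps_def)

lemma gauss_fps_nth_eq_gauss_coeff:
  "fps_nth (gauss_fps (\<sigma>\<^sup>2 / 2)) j = (if even j then gauss_coeff \<sigma> j else 0)"
  by (auto simp: gauss_fps_nth gauss_coeff_def C_even power_divide power_mult elim!: evenE)

lemma coeff_norm_gauss_fps_tail_le:
  assumes "s \<ge> 0"
  shows "(\<Sum>n\<in>{2*r..k}. \<bar>fps_nth (gauss_fps a) n\<bar> * s ^ n) \<le> (\<bar>a\<bar> * s\<^sup>2) ^ r * exp (\<bar>a\<bar> * s\<^sup>2)"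
proof -
  have "(\<Sum>n\<in>{2*r..k}. \<bar>fps_nth (gauss_fps a) n\<bar> * s ^ n)
      = (\<Sum>n\<in>{n\<in>{2*r..k}. even n}. \<bar>fps_nth (gauss_fps a) n\<bar> * s ^ n)"
    by (rule sum.mono_neutral_right) (auto simp: gauss_fps_nth)
  also have "\<dots> \<le> (\<Sum>n\<in>(*) 2 ` {r..k}. \<bar>fps_nth (gauss_fps a) n\<bar> * s ^ n)"
    using assms by (intro sum_mono2) (auto elim!: evenE)
  also have "\<dots> = (\<Sum>i\<in>{r..k}. (\<bar>a\<bar> * s\<^sup>2) ^ i / fact i)"
    by (subst sum.reindex) (auto simp: inj_on_def gauss_fps_nth power_mult_distrib power_mult power_abs)
  also have "\<dots> \<le> (\<bar>a\<bar> * s\<^sup>2) ^ r * exp (\<bar>a\<bar> * s\<^sup>2)"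
    using assms by (intro exp_series_segment_le) auto
  finally show ?thesis .
qed

lemma coeff_norm_gauss_fps_le:
  assumes "s \<ge> 0"
  shows "coeff_norm k s (gauss_fps a) \<le> exp (\<bar>a\<bar> * s\<^sup>2)"
  using coeff_norm_gauss_fps_tail_le[OF assms, where r = 0 and k = k and a = a] by (simp add: coeff_norm_def atLeast0AtMost)

text \<open>
  Perturbation principle: the terms of \<open>H\<close> beyond the constant one change the Gaussian coefficient
  at \<open>j\<close> by \<open>\<Sum>i. \<bar>H\<^sub>i\<bar> * gauss_coeff \<sigma> (j - i)\<close> at most, and \<open>gauss_coeff_le_shift\<close> bounds each
  summand by \<open>gauss_coeff \<sigma> j * \<bar>H\<^sub>i\<bar> * s ^ i\<close>.
\<close>

lemma gauss_times_perturbation_nth: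
  assumes "\<sigma> > 0" "j \<le> k" "s = 2 * sqrt (real k) / \<sigma>" "fps_nth H 0 = 1"
  shows "\<bar>fps_nth (gauss_fps (\<sigma>\<^sup>2 / 2) * H) j - (if even j then gauss_coeff \<sigma> j else 0)\<bar>
     \<le> gauss_coeff \<sigma> j * (coeff_norm k s H - 1)"
proof -
  let ?Q = "gauss_fps (\<sigma>\<^sup>2 / 2)"
  have s: "s \<ge> 0" using assms by simp
  have "?Q * H = ?Q + ?Q * (H - 1)" by (simp add: algebra_simps)
  then have "fps_nth (?Q * H) j - (if even j then gauss_coeff \<sigma> j else 0) = fps_nth ((H - 1) * ?Q) j"
    by (simp add: gauss_fps_nth_eq_gauss_coeff mult.commute)
  also have "\<bar>\<dots>\<bar> \<le> (\<Sum>i=0..j. \<bar>fps_nth (H - 1) i * fps_nth ?Q (j - i)\<bar>)"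
    unfolding fps_mult_nth by (rule sum_abs)
  also have "\<dots> \<le> (\<Sum>i=0..j. \<bar>fps_nth (H - 1) i\<bar> * (s ^ i * gauss_coeff \<sigma> j))"
  proof (rule sum_mono)
    fix i assume i: "i \<in> {0..j}"
    have "\<bar>fps_nth ?Q (j - i)\<bar> \<le> gauss_coeff \<sigma> (j - i)"
      using gauss_coeff_pos[OF assms(1), of "j - i"] by (simp add: gauss_fps_nth_eq_gauss_coeff)
    also have "\<dots> \<le> s ^ (j - (j - i)) * gauss_coeff \<sigma> j"
      unfolding assms(3) using assms(1,2) by (intro gauss_coeff_le_shift) auto
    finally show "\<bar>fps_nth (H - 1) i * fps_nth ?Q (j - i)\<bar> \<le> \<bar>fps_nth (H - 1) i\<bar> * (s ^ i * gauss_coeff \<sigma> j)"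
      using i by (simp add: abs_mult mult_left_mono)
  qed
  also have "\<dots> = gauss_coeff \<sigma> j * (\<Sum>i=0..j. \<bar>fps_nth (H - 1) i\<bar> * s ^ i)"
    by (simp add: sum_distrib_left mult_ac)
  also have "\<dots> \<le> gauss_coeff \<sigma> j * coeff_norm k s (H - 1)"
    unfolding coeff_norm_def using assms(1,2) s gauss_coeff_pos[OF assms(1), of j]
    by (intro mult_left_mono sum_mono2) auto
  finally show ?thesis by (simp add: coeff_norm_minus_one assms(4))
qed

section \<open>The random model\<close>

text \<open>
  Moment generating function of a centred Bernoulli variable, which takes the value \<open>1 - q\<close> with
  probability \<open>q\<close> and the value \<open>- q\<close> otherwise.
\<close>

definition bernoulli_factor :: "real \<Rightarrow> real fps"
  where "bernoulli_factor q = fps_const (1 - q) * fps_exp (- q) + fps_const q * fps_exp (1 - q)"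

lemma bernoulli_factor_nth:
  "fps_nth (bernoulli_factor q) n = ((1 - q) * (- q) ^ n + q * (1 - q) ^ n) / fact n"
  by (simp add: bernoulli_factor_def add_divide_distrib)

lemma exp_two_le: "exp 2 \<le> (9::real)"
proof -
  have "exp (2::real) = exp 1 * exp 1" by (simp flip: exp_add)
  also have "\<dots> \<le> 3 * 3" using exp_le by (intro mult_mono) auto
  finally show ?thesis by simp
qed

text \<open>
  Centring removes the linear term, and the Gaussian factor with the same variance removes the
  quadratic one. What is left starts at \<open>t ^ 3\<close> and is proportional to the variance \<open>v\<close>, because
  every moment of order at least \<open>2\<close> is bounded by \<open>v\<close>. Keeping the factor \<open>v\<close> is essential, as
  these bounds will be multiplied over all primes.
\<close>

lemma coeff_norm_bernoulli_factor_le: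
  assumes q: "0 \<le> q" "q \<le> 1" and s: "0 \<le> s" "s \<le> 2"
  defines "v \<equiv> q * (1 - q)"
  shows "coeff_norm k s (bernoulli_factor q * gauss_fps (- v / 2)) \<le> exp (30 * v * s ^ 3)"
proof -
  \<comment> \<open>The factors are \<open>1 + U + h\<close> and \<open>1 - U + r\<close>, where \<open>h\<close> starts at \<open>t ^ 3\<close> and \<open>r\<close> at \<open>t ^ 4\<close>,
     so their product is \<open>1 - U\<^sup>2 + r + U * r + h * Q\<close>.\<close>
  define Q where "Q = gauss_fps (- v / 2)"
  define U where "U = fps_const (v / 2) * fps_X ^ 2"
  define h where "h = bernoulli_factor q - 1 - U"
  define r where "r = Q - 1 + U"
  define u where "u = v / 2 * s\<^sup>2"
  have v: "0 \<le> v" "v \<le> 1 / 4"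
  proof -
    show "0 \<le> v" using q by (simp add: v_def)
    have "0 \<le> (q - 1 / 2)\<^sup>2" by simp
    then show "v \<le> 1 / 4" by (simp add: v_def power2_eq_square algebra_simps)
  qed
  have s2: "s\<^sup>2 \<le> 2\<^sup>2" using s by (intro power_mono)
  have u: "0 \<le> u" "u \<le> 1 / 2"
  proof -
    show "0 \<le> u" using v by (simp add: u_def)
    have "v / 2 * s\<^sup>2 \<le> (1 / 4) / 2 * 2\<^sup>2" using v s2 by (intro mult_mono) auto
    then show "u \<le> 1 / 2" by (simp add: u_def)
  qed
  have U_nth: "fps_nth U n = (if n = 2 then v / 2 else 0)" for n
    by (simp add: U_def fps_X_power_nth)
  have norm_U: "coeff_norm k s U \<le> u"
    using s v by (simp add: coeff_norm_def U_nth u_def if_distrib if_distribR cong: if_cong)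
  have norm_Q: "coeff_norm k s Q \<le> 3"
  proof -
    have "coeff_norm k s Q \<le> exp u"
      using coeff_norm_gauss_fps_le[OF s(1), of k "- v / 2"] v by (simp add: Q_def u_def)
    also have "\<dots> \<le> exp 1" using u by simp
    also have "\<dots> \<le> 3" by (rule exp_le)
    finally show ?thesis .
  qed
  have norm_r: "coeff_norm k s r \<le> 3 * u\<^sup>2"
  proof -
    have r_nth: "fps_nth r n = (if n < 4 then 0 else fps_nth Q n)" for n
    proof -
      consider "n = 0" | "n = 1" | "n = 2" | "n = 3" | "n \<ge> 4" by linarith
      then show ?thesis
        by cases (auto simp: r_def Q_def gauss_fps_nth U_nth)
    qed
    have "coeff_norm k s r = (\<Sum>n\<in>{2*2..k}. \<bar>fps_nth Q n\<bar> * s ^ n)"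
      unfolding coeff_norm_def by (intro sum.mono_neutral_cong_right) (auto simp: r_nth)
    also have "\<dots> \<le> u\<^sup>2 * exp u"
      using coeff_norm_gauss_fps_tail_le[OF s(1), where r = 2 and k = k and a = "- v / 2"] v by (simp add: Q_def u_def)
    also have "\<dots> \<le> u\<^sup>2 * 3"
    proof (rule mult_left_mono)
      have "exp u \<le> exp 1" using u by simp
      then show "exp u \<le> 3" using exp_le by linarith
    qed simp
    finally show ?thesis by simp
  qed
  have norm_h: "coeff_norm k s h \<le> 9 * v * s ^ 3"
  proof -
    have h_le: "\<bar>fps_nth h n\<bar> \<le> (if n < 3 then 0 else v / fact n)" for n
    proof -
      consider "n = 0" | "n = 1" | "n = 2" | "n \<ge> 3" by linarith
      then show ?thesis
      proof cases
        case 4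
        have "(1 - q) * q ^ n \<le> (1 - q) * q ^ 2" "q * (1 - q) ^ n \<le> q * (1 - q) ^ 2"
          using q 4 by (auto intro!: mult_left_mono power_decreasing)
        moreover have "(1 - q) * q ^ 2 + q * (1 - q) ^ 2 = v"
          by (simp add: v_def power2_eq_square algebra_simps)
        moreover have "\<bar>(1 - q) * (- q) ^ n + q * (1 - q) ^ n\<bar> \<le> (1 - q) * q ^ n + q * (1 - q) ^ n"
        proof -
          have "\<bar>(1 - q) * (- q) ^ n + q * (1 - q) ^ n\<bar> \<le> \<bar>(1 - q) * (- q) ^ n\<bar> + \<bar>q * (1 - q) ^ n\<bar>"
            by (rule abs_triangle_ineq)
          also have "\<dots> = (1 - q) * q ^ n + q * (1 - q) ^ n"
            using q by (simp add: abs_mult power_abs)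
          finally show ?thesis .
        qed
        ultimately have "\<bar>(1 - q) * (- q) ^ n + q * (1 - q) ^ n\<bar> \<le> v" by linarith
        then have "\<bar>fps_nth (bernoulli_factor q) n\<bar> \<le> v / fact n"
          unfolding bernoulli_factor_nth abs_divide by (simp add: divide_right_mono)
        then show ?thesis using 4 by (simp add: h_def U_nth)
      qed (auto simp: h_def bernoulli_factor_nth U_nth v_def power2_eq_square field_simps)
    qed
    have "coeff_norm k s h \<le> (\<Sum>n\<le>k. (if n < 3 then 0 else v / fact n) * s ^ n)"
      unfolding coeff_norm_def using s by (intro sum_mono mult_right_mono h_le) auto
    also have "\<dots> = (\<Sum>n\<in>{3..k}. v * (s ^ n / fact n))"
      by (intro sum.mono_neutral_cong_right) auto
    also have "\<dots> = v * (\<Sum>n\<in>{3..k}. s ^ n / fact n)" by (simp add: sum_distrib_left)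
    also have "\<dots> \<le> v * (s ^ 3 * exp s)"
      using v s by (intro mult_left_mono exp_series_segment_le) auto
    also have "\<dots> \<le> v * (s ^ 3 * 9)"
    proof (intro mult_left_mono)
      have "exp s \<le> exp 2" using s by simp
      then show "exp s \<le> 9" using exp_two_le by linarith
    qed (use v s in auto)
    finally show ?thesis by (simp add: mult_ac)
  qed
  have expand: "bernoulli_factor q * Q = 1 + (fps_const (-1) * (U * U) + (r + U * r + h * Q))"
  proof -
    have "fps_const (-1) = (-1 :: real fps)" using fps_const_neg[of "1::real"] by simp
    then have "(1 + U) * (1 - U + r) = 1 + (fps_const (-1) * (U * U) + (r + U * r))"
      by (simp only:) (simp add: algebra_simps)
    moreover have "1 - U + r = Q" "bernoulli_factor q = (1 + U) + h" by (simp_all add: h_def r_def)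
    ultimately show ?thesis by (simp add: distrib_right add.assoc)
  qed
  have u2: "u\<^sup>2 \<le> v * s ^ 3 / 8"
  proof -
    have "u\<^sup>2 = v * s ^ 3 * (v * s / 4)" by (simp add: u_def power2_eq_square power3_eq_cube)
    also have "v * s \<le> 1 / 4 * 2" using v s by (intro mult_mono) auto
    finally show ?thesis using v s by (simp add: mult_left_mono)
  qed
  have m1: "coeff_norm k s (fps_const (-1) * (U * U)) = coeff_norm k s (U * U)"
    by (simp add: coeff_norm_def)
  have m2: "coeff_norm k s (U * U) \<le> u * u"
    by (rule order.trans[OF coeff_norm_mult_le[OF s(1)]])
      (intro mult_mono norm_U u coeff_norm_nonneg s)
  have m3: "coeff_norm k s (U * r) \<le> u * (3 * u\<^sup>2)"
    by (rule order.trans[OF coeff_norm_mult_le[OF s(1)]])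
      (intro mult_mono norm_U norm_r u coeff_norm_nonneg s)
  have m4: "coeff_norm k s (h * Q) \<le> 9 * v * s ^ 3 * 3"
    by (rule order.trans[OF coeff_norm_mult_le[OF s(1)]])
      (use v s in \<open>intro mult_mono norm_h norm_Q coeff_norm_nonneg s; simp\<close>)
  note add_le = coeff_norm_add_le[OF s(1), of k]
  have "coeff_norm k s (bernoulli_factor q * Q) \<le> 1 + (u * u + (3 * u\<^sup>2 + u * (3 * u\<^sup>2) + 9 * v * s ^ 3 * 3))"
    unfolding expand
    using add_le[of 1 "fps_const (-1) * (U * U) + (r + U * r + h * Q)"]
      add_le[of "fps_const (-1) * (U * U)" "r + U * r + h * Q"]
      add_le[of "r + U * r" "h * Q"] add_le[of r "U * r"] m1 m2 m3 m4 norm_r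
      coeff_norm_one[of k s] by linarith
  also have "u * (3 * u\<^sup>2) \<le> 1 / 2 * (3 * u\<^sup>2)" using u by (intro mult_right_mono) auto
  also have "u * u = u\<^sup>2" by (simp add: power2_eq_square)
  finally have "coeff_norm k s (bernoulli_factor q * Q)
      \<le> 1 + (u\<^sup>2 + (3 * u\<^sup>2 + 1 / 2 * (3 * u\<^sup>2) + 27 * (v * s ^ 3)))" by (simp add: mult_ac)
  moreover have "0 \<le> v * s ^ 3" using v s by simp
  ultimately have "coeff_norm k s (bernoulli_factor q * Q) \<le> 1 + 30 * (v * s ^ 3)"
    using u2 by linarith
  then have "coeff_norm k s (bernoulli_factor q * Q) \<le> 1 + 30 * v * s ^ 3" by (simp add: mult.assoc)
  also have "\<dots> \<le> exp (30 * v * s ^ 3)" by (rule exp_ge_add_one_self)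
  finally show ?thesis by (simp add: Q_def)
qed

text \<open>
  The probability that a random subset of \<open>P\<close>, containing each \<open>p\<close> independently with probability
  \<open>q p\<close>, equals \<open>S\<close>.
\<close>

definition subset_weight :: "('a \<Rightarrow> real) \<Rightarrow> 'a set \<Rightarrow> 'a set \<Rightarrow> real"
  where "subset_weight q P S = (\<Prod>p\<in>S. q p) * (\<Prod>p\<in>P - S. 1 - q p)"

lemma fps_exp_of_nat: "fps_exp (real n) = fps_exp 1 ^ n"
  by (simp add: fps_exp_power_mult)

lemma fps_const_prod_eq: "fps_const (\<Prod>i\<in>A. f i) = (\<Prod>i\<in>A. fps_const (f i :: real))"
  by (induction A rule: infinite_finite_induct) (simp_all flip: fps_const_mult)

lemma fps_nth_prod_0: "fps_nth (\<Prod>i\<in>A. f i) 0 = (\<Prod>i\<in>A. fps_nth (f i :: real fps) 0)"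
  by (induction A rule: infinite_finite_induct) simp_all

text \<open>
  Independence in algebraic form: expanding the product over \<open>P\<close> gives the sum over all subsets.
  The exponential prefactor collects the means, so that every factor is centred.
\<close>

lemma model_generating_function:
  assumes "finite P"
  shows "(\<Sum>S\<in>Pow P. fps_const (subset_weight q P S) * fps_exp (real (card S) + c))
     = fps_exp (c + (\<Sum>p\<in>P. q p)) * (\<Prod>p\<in>P. bernoulli_factor (q p))"
proof -
  have "(\<Sum>S\<in>Pow P. fps_const (subset_weight q P S) * fps_exp (real (card S) + c))
     = fps_exp c * (\<Sum>S\<in>Pow P. (\<Prod>p\<in>S. fps_const (q p) * fps_exp 1) * (\<Prod>p\<in>P - S. fps_const (1 - q p)))"
    unfolding sum_distrib_left
    by (intro sum.cong refl)
      (simp add: subset_weight_def prod.distrib fps_exp_add_mult fps_exp_of_nat fps_const_prod_eq mult_ac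
        flip: fps_const_mult)
  also have "\<dots> = fps_exp c * (\<Prod>p\<in>P. fps_const (q p) * fps_exp 1 + fps_const (1 - q p))"
    using assms by (simp add: prod_add)
  also have "(\<Prod>p\<in>P. fps_const (q p) * fps_exp 1 + fps_const (1 - q p))
     = (\<Prod>p\<in>P. fps_exp (q p) * bernoulli_factor (q p))"
    by (intro prod.cong refl)
      (simp add: bernoulli_factor_def distrib_left add.commute mult.left_commute[of "fps_exp _"] flip: fps_exp_add_mult)
  also have "\<dots> = fps_exp (\<Sum>p\<in>P. q p) * (\<Prod>p\<in>P. bernoulli_factor (q p))"
  proof -
    have "fps_exp (\<Sum>p\<in>P. q p) = (\<Prod>p\<in>P. fps_exp (q p))"
      using assms by (induction P rule: finite_induct) (simp_all add: fps_exp_add_mult)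
    then show ?thesis by (simp add: prod.distrib)
  qed
  finally show ?thesis by (simp add: fps_exp_add_mult mult.assoc)
qed

text \<open>
  The generating function is \<open>exp (\<sigma>\<^sup>2 * t\<^sup>2 / 2) * H t\<close>, where \<open>H\<close> consists of the shift of the mean,
  the discrepancy between \<open>V\<close> and \<open>\<sigma>\<^sup>2\<close>, and the corrected Bernoulli factors. The three summands
  in the exponent bound the majorant norms of these three parts.
\<close>

theorem model_moment_estimate:
  assumes P: "finite P" and q: "\<And>p. p \<in> P \<Longrightarrow> 0 \<le> q p \<and> q p \<le> 1"
    and \<sigma>: "\<sigma> > 0" and j: "j \<le> k"
    and s: "s = 2 * sqrt (real k) / \<sigma>" "s \<le> 2"
    and V: "V = (\<Sum>p\<in>P. q p * (1 - q p))"
  shows "\<bar>(\<Sum>S\<in>Pow P. subset_weight q P S * (real (card S) + c) ^ j) - (if even j then C j * \<sigma> ^ j else 0)\<bar>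
     \<le> C j * \<sigma> ^ j * (exp (\<bar>c + (\<Sum>p\<in>P. q p)\<bar> * s + \<bar>V - \<sigma>\<^sup>2\<bar> / 2 * s\<^sup>2 + 30 * V * s ^ 3) - 1)"
proof -
  define \<mu> where "\<mu> = (\<Sum>p\<in>P. q p)"
  define v where "v p = q p * (1 - q p)" for p
  define H where "H = fps_exp (c + \<mu>) * (gauss_fps ((V - \<sigma>\<^sup>2) / 2)
      * (\<Prod>p\<in>P. bernoulli_factor (q p) * gauss_fps (- v p / 2)))"
  have s0: "s \<ge> 0" using s \<sigma> by simp
  have "(\<Prod>p\<in>P. bernoulli_factor (q p) * gauss_fps (- v p / 2))
      = (\<Prod>p\<in>P. bernoulli_factor (q p)) * gauss_fps (\<Sum>p\<in>P. - v p / 2)"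
    by (simp add: prod.distrib gauss_fps_sum)
  also have "(\<Sum>p\<in>P. - v p / 2) = - V / 2"
    by (simp add: V v_def sum_negf sum_divide_distrib)
  finally have prod_eq: "(\<Prod>p\<in>P. bernoulli_factor (q p) * gauss_fps (- v p / 2))
      = (\<Prod>p\<in>P. bernoulli_factor (q p)) * gauss_fps (- V / 2)" .
  have "gauss_fps (\<sigma>\<^sup>2 / 2) * gauss_fps ((V - \<sigma>\<^sup>2) / 2) * gauss_fps (- V / 2) = gauss_fps 0"
    unfolding gauss_fps_add[symmetric] by (simp add: field_simps)
  also have "gauss_fps 0 = 1" by (simp add: gauss_fps_def)
  finally have gauss: "gauss_fps (\<sigma>\<^sup>2 / 2) * gauss_fps ((V - \<sigma>\<^sup>2) / 2) * gauss_fps (- V / 2) = 1" .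
  have "gauss_fps (\<sigma>\<^sup>2 / 2) * H = fps_exp (c + \<mu>) * (\<Prod>p\<in>P. bernoulli_factor (q p))
      * (gauss_fps (\<sigma>\<^sup>2 / 2) * gauss_fps ((V - \<sigma>\<^sup>2) / 2) * gauss_fps (- V / 2))"
    unfolding H_def prod_eq by (simp only: mult_ac)
  also have "\<dots> = (\<Sum>S\<in>Pow P. fps_const (subset_weight q P S) * fps_exp (real (card S) + c))"
    unfolding gauss by (simp add: model_generating_function[OF P] \<mu>_def)
  finally have "fps_nth (gauss_fps (\<sigma>\<^sup>2 / 2) * H) j
      = (\<Sum>S\<in>Pow P. subset_weight q P S * (real (card S) + c) ^ j) / fact j"
    by (simp add: fps_sum_nth sum_divide_distrib)
  then have moment: "(\<Sum>S\<in>Pow P. subset_weight q P S * (real (card S) + c) ^ j)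
      = fact j * fps_nth (gauss_fps (\<sigma>\<^sup>2 / 2) * H) j" by simp
  have H0: "fps_nth H 0 = 1"
    by (simp add: H_def gauss_fps_nth bernoulli_factor_nth fps_nth_prod_0 algebra_simps)
  have "coeff_norm k s H \<le> exp (\<bar>c + \<mu>\<bar> * s) * (exp (\<bar>(V - \<sigma>\<^sup>2) / 2\<bar> * s\<^sup>2) * (\<Prod>p\<in>P. exp (30 * v p * s ^ 3)))"
    unfolding H_def
  proof (rule order.trans[OF coeff_norm_mult_le[OF s0]], rule mult_mono)
    show "coeff_norm k s (gauss_fps ((V - \<sigma>\<^sup>2) / 2) * (\<Prod>p\<in>P. bernoulli_factor (q p) * gauss_fps (- v p / 2)))
      \<le> exp (\<bar>(V - \<sigma>\<^sup>2) / 2\<bar> * s\<^sup>2) * (\<Prod>p\<in>P. exp (30 * v p * s ^ 3))"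
    proof (rule order.trans[OF coeff_norm_mult_le[OF s0]], rule mult_mono)
      show "coeff_norm k s (\<Prod>p\<in>P. bernoulli_factor (q p) * gauss_fps (- v p / 2)) \<le> (\<Prod>p\<in>P. exp (30 * v p * s ^ 3))"
      proof (rule order.trans[OF coeff_norm_prod_le[OF s0]], rule prod_mono, rule conjI)
        fix p assume "p \<in> P"
        then show "coeff_norm k s (bernoulli_factor (q p) * gauss_fps (- v p / 2)) \<le> exp (30 * v p * s ^ 3)"
          unfolding v_def using q s0 s(2) by (intro coeff_norm_bernoulli_factor_le) auto
      qed (rule coeff_norm_nonneg[OF s0])
    qed (rule coeff_norm_gauss_fps_le[OF s0] coeff_norm_nonneg[OF s0] | simp)+
  qed (use s0 in \<open>auto intro!: coeff_norm_nonneg coeff_norm_fps_exp_le\<close>)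
  also have "\<dots> = exp (\<bar>c + \<mu>\<bar> * s + \<bar>V - \<sigma>\<^sup>2\<bar> / 2 * s\<^sup>2 + 30 * V * s ^ 3)"
    by (simp add: exp_add V v_def sum_distrib_left sum_distrib_right mult.assoc flip: exp_sum[OF P])
  finally have norm_H: "coeff_norm k s H \<le> exp (\<bar>c + \<mu>\<bar> * s + \<bar>V - \<sigma>\<^sup>2\<bar> / 2 * s\<^sup>2 + 30 * V * s ^ 3)" .
  have main: "(if even j then C j * \<sigma> ^ j else 0) = fact j * (if even j then gauss_coeff \<sigma> j else 0)"
    "C j * \<sigma> ^ j = fact j * gauss_coeff \<sigma> j"
    by (auto simp: gauss_coeff_def)
  have "\<bar>fact j * fps_nth (gauss_fps (\<sigma>\<^sup>2 / 2) * H) j - fact j * (if even j then gauss_coeff \<sigma> j else 0)\<bar>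
      = fact j * \<bar>fps_nth (gauss_fps (\<sigma>\<^sup>2 / 2) * H) j - (if even j then gauss_coeff \<sigma> j else 0)\<bar>"
    by (subst right_diff_distrib[symmetric]) (simp add: abs_mult)
  also have "\<dots> \<le> fact j * (gauss_coeff \<sigma> j * (coeff_norm k s H - 1))"
    by (intro mult_left_mono gauss_times_perturbation_nth \<sigma> j s H0) auto
  also have "\<dots> \<le> fact j * (gauss_coeff \<sigma> j * (exp (\<bar>c + \<mu>\<bar> * s + \<bar>V - \<sigma>\<^sup>2\<bar> / 2 * s\<^sup>2 + 30 * V * s ^ 3) - 1))"
    using norm_H gauss_coeff_pos[OF \<sigma>, of j] by (intro mult_left_mono) auto
  finally show ?thesis unfolding moment main(1) unfolding main(2) \<mu>_def by (simp only: mult.assoc)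
qed

section \<open>From integers to the model\<close>

text \<open>
  The \<open>j\<close>-th power of the size of \<open>S\<close> counts the tuples of length \<open>j\<close> in \<open>S\<close>. Summing over tuples in
  the larger set \<open>P\<close> makes the range independent of \<open>S\<close>.
\<close>

lemma card_power_eq_sum_lists:
  assumes "finite P" "S \<subseteq> P"
  shows "real (card S) ^ j = (\<Sum>xs | set xs \<subseteq> P \<and> length xs = j. of_bool (set xs \<subseteq> S))"
proof -
  have fin: "finite {xs. set xs \<subseteq> P \<and> length xs = j}"
    using assms(1) by (rule finite_lists_length_eq)
  have "real (card S) ^ j = real (card {xs. set xs \<subseteq> S \<and> length xs = j})"
    using assms by (simp add: card_lists_length_eq finite_subset)
  also have "{xs. set xs \<subseteq> S \<and> length xs = j} = {xs \<in> {xs. set xs \<subseteq> P \<and> length xs = j}. set xs \<subseteq> S}"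
    using assms(2) by auto
  also have "real (card \<dots>) = (\<Sum>xs | set xs \<subseteq> P \<and> length xs = j. of_bool (set xs \<subseteq> S))"
    using fin by (simp add: sum_of_bool_eq Int_def)
  finally show ?thesis .
qed

text \<open>
  The event \<open>D \<subseteq> S\<close> has probability \<open>\<Prod>p\<in>D. q p\<close>: it amounts to deleting, for \<open>p\<close> in \<open>D\<close>, the
  alternative \<open>1 - q p\<close> from the product of the sums \<open>q p + (1 - q p)\<close>.
\<close>

lemma subset_weight_superset_sum:
  assumes "finite P" "D \<subseteq> P"
  shows "(\<Sum>S\<in>Pow P. subset_weight q P S * of_bool (D \<subseteq> S)) = (\<Prod>p\<in>D. q p)"
proof -
  have "(\<Prod>p\<in>D. q p) = (\<Prod>p\<in>P. if p \<in> D then q p else 1)"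
    using assms by (simp add: prod.inter_restrict[symmetric] Int_absorb1 prod.If_cases)
  also have "\<dots> = (\<Prod>p\<in>P. q p + (if p \<in> D then 0 else 1 - q p))"
    by (intro prod.cong) auto
  also have "\<dots> = (\<Sum>S\<in>Pow P. (\<Prod>p\<in>S. q p) * (\<Prod>p\<in>P - S. if p \<in> D then 0 else 1 - q p))"
    using assms(1) by (rule prod_add)
  also have "\<dots> = (\<Sum>S\<in>Pow P. subset_weight q P S * of_bool (D \<subseteq> S))"
  proof (intro sum.cong refl)
    fix S assume "S \<in> Pow P"
    show "(\<Prod>p\<in>S. q p) * (\<Prod>p\<in>P - S. if p \<in> D then 0 else 1 - q p) = subset_weight q P S * of_bool (D \<subseteq> S)"
    proof (cases "D \<subseteq> S")
      case True
      then have "(\<Prod>p\<in>P - S. if p \<in> D then 0 else 1 - q p) = (\<Prod>p\<in>P - S. 1 - q p)"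
        by (intro prod.cong) auto
      then show ?thesis using True by (simp add: subset_weight_def)
    next
      case False
      then have "(\<Prod>p\<in>P - S. if p \<in> D then 0 else 1 - q p) = 0"
        using assms by (intro prod_zero) auto
      then show ?thesis using False by simp
    qed
  qed
  finally show ?thesis by simp
qed

definition omega_upto :: "nat \<Rightarrow> nat \<Rightarrow> nat"
  where "omega_upto z n = card {p \<in> primes_upto z. p dvd n}"

lemma card_common_multiples_approx:
  assumes D: "D \<subseteq> primes_upto z" and x: "x \<ge> 0"
  shows "\<bar>real (card {n \<in> {1..nat \<lfloor>x\<rfloor>}. \<forall>p\<in>D. p dvd n}) - x * (\<Prod>p\<in>D. 1 / real p)\<bar> \<le> 1"
proof -
  define d where "d = \<Prod>D"
  define N where "N = nat \<lfloor>x\<rfloor>"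
  have fin: "finite D" using D finite_primes_upto by (rule finite_subset)
  have prime: "prime p" if "p \<in> D" for p using D that by (auto simp: primes_upto_def)
  have d: "d > 0" unfolding d_def by (intro prod_pos) (auto dest: prime prime_gt_0_nat)
  have "{n \<in> {1..N}. \<forall>p\<in>D. p dvd n} = {n. 1 \<le> n \<and> n \<le> N \<and> d dvd n}"
    unfolding d_def using prod_primes_dvd_iff[OF fin prime] by auto
  then have card: "card {n \<in> {1..N}. \<forall>p\<in>D. p dvd n} = N div d"
    using card_multiples[OF d] by simp
  have N: "real N \<le> x" "x \<le> real N + 1" using x unfolding N_def by linarith+
  have "real (N div d) \<le> real N / real d" by (rule div_real_bounds[OF d])
  also have "\<dots> \<le> x / real d" using N by (intro divide_right_mono) auto
  finally have upper: "real (N div d) \<le> x / real d" .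
  have "N < d * (N div d) + d" using d by (metis add.commute mod_less_divisor mult_div_mod_eq nat_add_left_cancel_less)
  then have "real (N + 1) \<le> real (d * (N div d) + d)" by (intro of_nat_mono) simp
  then have "x \<le> real d * (real (N div d) + 1)" using N by (simp add: algebra_simps)
  then have lower: "x / real d \<le> real (N div d) + 1" using d by (simp add: field_simps)
  have "(\<Prod>p\<in>D. 1 / real p) = 1 / real d" by (simp add: d_def prod_dividef)
  with upper lower card show ?thesis unfolding N_def by simp
qed

lemma card_primes_upto_le: "card (primes_upto z) \<le> z"
proof -
  have "card (primes_upto z) \<le> card {1..z}"
    by (intro card_mono) (auto simp: primes_upto_def dest: prime_gt_0_nat)
  then show ?thesis by simp
qed

abbreviation prime_model :: "nat \<Rightarrow> nat set \<Rightarrow> real"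
  where "prime_model z \<equiv> subset_weight (\<lambda>p. 1 / real p) (primes_upto z)"

text \<open>
  Both moments are sums over tuples of primes. For each tuple, the integers contribute the number
  of common multiples up to \<open>x\<close> and the model contributes \<open>x\<close> times a probability; the two differ
  by at most \<open>1\<close>.
\<close>

lemma raw_moment_transfer:
  assumes x: "x \<ge> 0"
  shows "\<bar>(\<Sum>n=1..nat \<lfloor>x\<rfloor>. real (omega_upto z n) ^ j)
      - x * (\<Sum>S\<in>Pow (primes_upto z). prime_model z S * real (card S) ^ j)\<bar> \<le> real z ^ j"
proof -
  let ?P = "primes_upto z"
  let ?X = "{xs. set xs \<subseteq> ?P \<and> length xs = j}"
  let ?A = "\<lambda>D. {n \<in> {1..nat \<lfloor>x\<rfloor>}. \<forall>p\<in>D. p dvd n}"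
  have "(\<Sum>n=1..nat \<lfloor>x\<rfloor>. real (omega_upto z n) ^ j)
      = (\<Sum>n=1..nat \<lfloor>x\<rfloor>. \<Sum>xs\<in>?X. of_bool (set xs \<subseteq> {p \<in> ?P. p dvd n}))"
    unfolding omega_upto_def by (intro sum.cong refl card_power_eq_sum_lists) auto
  also have "\<dots> = (\<Sum>xs\<in>?X. \<Sum>n=1..nat \<lfloor>x\<rfloor>. of_bool (set xs \<subseteq> {p \<in> ?P. p dvd n}))"
    by (rule sum.swap)
  also have "\<dots> = (\<Sum>xs\<in>?X. real (card (?A (set xs))))"
  proof (intro sum.cong refl)
    fix xs assume "xs \<in> ?X"
    then have "set xs \<subseteq> {p \<in> ?P. p dvd n} \<longleftrightarrow> (\<forall>p\<in>set xs. p dvd n)" for n by auto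
    then show "(\<Sum>n=1..nat \<lfloor>x\<rfloor>. of_bool (set xs \<subseteq> {p \<in> ?P. p dvd n})) = real (card (?A (set xs)))"
      by (simp add: sum_of_bool_eq Int_def)
  qed
  finally have integers: "(\<Sum>n=1..nat \<lfloor>x\<rfloor>. real (omega_upto z n) ^ j) = (\<Sum>xs\<in>?X. real (card (?A (set xs))))" .
  have "(\<Sum>S\<in>Pow ?P. prime_model z S * real (card S) ^ j)
      = (\<Sum>S\<in>Pow ?P. \<Sum>xs\<in>?X. prime_model z S * of_bool (set xs \<subseteq> S))"
    by (intro sum.cong refl) (simp add: card_power_eq_sum_lists[of ?P] sum_distrib_left)
  also have "\<dots> = (\<Sum>xs\<in>?X. \<Sum>S\<in>Pow ?P. prime_model z S * of_bool (set xs \<subseteq> S))"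
    by (rule sum.swap)
  also have "\<dots> = (\<Sum>xs\<in>?X. \<Prod>p\<in>set xs. 1 / real p)"
    by (intro sum.cong refl subset_weight_superset_sum) auto
  finally have model: "(\<Sum>S\<in>Pow ?P. prime_model z S * real (card S) ^ j) = (\<Sum>xs\<in>?X. \<Prod>p\<in>set xs. 1 / real p)" .
  have "\<bar>(\<Sum>n=1..nat \<lfloor>x\<rfloor>. real (omega_upto z n) ^ j)
      - x * (\<Sum>S\<in>Pow ?P. prime_model z S * real (card S) ^ j)\<bar>
     = \<bar>\<Sum>xs\<in>?X. real (card (?A (set xs))) - x * (\<Prod>p\<in>set xs. 1 / real p)\<bar>"
    unfolding integers model by (simp add: sum_subtractf sum_distrib_left)
  also have "\<dots> \<le> (\<Sum>xs\<in>?X. \<bar>real (card (?A (set xs))) - x * (\<Prod>p\<in>set xs. 1 / real p)\<bar>)"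
    by (rule sum_abs)
  also have "\<dots> \<le> (\<Sum>xs\<in>?X. 1)"
    by (intro sum_mono card_common_multiples_approx x) auto
  also have "\<dots> = real (card ?P) ^ j" by (simp add: card_lists_length_eq)
  also have "\<dots> \<le> real z ^ j"
    using card_primes_upto_le[of z] by (intro power_mono) auto
  finally show ?thesis .
qed

text \<open>
  The binomial expansion turns the errors \<open>z ^ i\<close> of the raw moments into \<open>(z + \<bar>c\<bar>) ^ j\<close>.
\<close>

lemma shifted_moment_transfer:
  assumes x: "x \<ge> 0"
  shows "\<bar>(\<Sum>n=1..nat \<lfloor>x\<rfloor>. (real (omega_upto z n) + c) ^ j)
      - x * (\<Sum>S\<in>Pow (primes_upto z). prime_model z S * (real (card S) + c) ^ j)\<bar> \<le> (real z + \<bar>c\<bar>) ^ j"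
proof -
  let ?P = "primes_upto z"
  define f where "f i = (\<Sum>n=1..nat \<lfloor>x\<rfloor>. real (omega_upto z n) ^ i)" for i
  define g where "g i = (\<Sum>S\<in>Pow ?P. prime_model z S * real (card S) ^ i)" for i
  define b where "b i = real (j choose i) * c ^ (j - i)" for i
  have bin: "(y + c) ^ j = (\<Sum>i\<le>j. b i * y ^ i)" for y
    unfolding binomial_ring b_def by (simp add: mult_ac)
  have "(\<Sum>n=1..nat \<lfloor>x\<rfloor>. (real (omega_upto z n) + c) ^ j) = (\<Sum>i\<le>j. b i * f i)"
    unfolding bin f_def sum_distrib_left by (rule sum.swap)
  moreover have "(\<Sum>S\<in>Pow ?P. prime_model z S * (real (card S) + c) ^ j) = (\<Sum>i\<le>j. b i * g i)"
    unfolding bin g_def sum_distrib_left by (subst sum.swap) (simp add: mult_ac)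
  ultimately have "\<bar>(\<Sum>n=1..nat \<lfloor>x\<rfloor>. (real (omega_upto z n) + c) ^ j)
      - x * (\<Sum>S\<in>Pow ?P. prime_model z S * (real (card S) + c) ^ j)\<bar> = \<bar>\<Sum>i\<le>j. b i * (f i - x * g i)\<bar>"
    by (simp add: sum_subtractf sum_distrib_left algebra_simps)
  also have "\<dots> \<le> (\<Sum>i\<le>j. \<bar>b i * (f i - x * g i)\<bar>)" by (rule sum_abs)
  also have "\<dots> \<le> (\<Sum>i\<le>j. \<bar>b i\<bar> * real z ^ i)"
    unfolding abs_mult f_def g_def by (intro sum_mono mult_left_mono raw_moment_transfer x) auto
  also have "\<dots> = (real z + \<bar>c\<bar>) ^ j"
    unfolding binomial_ring b_def by (simp add: abs_mult power_abs mult_ac)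
  finally show ?thesis .
qed

lemma omega_upto_le_omega:
  assumes "n > 0"
  shows "omega_upto z n \<le> omega n"
  unfolding omega_upto_def omega_def
  using assms by (intro card_mono) (auto simp: primes_upto_def prime_factors_dvd)

text \<open>
  More than \<open>m\<close> primes exceeding \<open>z\<close> would have a product of at least \<open>(z + 1) ^ m > n\<close>.
\<close>

lemma omega_le_omega_upto:
  assumes n: "n > 0" "real n < (real z + 1) ^ m"
  shows "omega n \<le> omega_upto z n + m"
proof -
  define B where "B = {p \<in> prime_factors n. p > z}"
  have fin: "finite B" by (simp add: B_def)
  have "prime_factors n = {p \<in> primes_upto z. p dvd n} \<union> B"
    using n by (auto simp: primes_upto_def prime_factors_dvd B_def)
  then have le: "omega n \<le> omega_upto z n + card B"
    unfolding omega_def omega_upto_def by (metis card_Un_le)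
  have "\<Prod>B dvd n"
    using fin by (subst prod_primes_dvd_iff) (auto simp: B_def)
  then have "\<Prod>B \<le> n" using n by (intro dvd_imp_le) auto
  have "(z + 1) ^ card B = (\<Prod>p\<in>B. z + 1)" by simp
  also have "\<dots> \<le> \<Prod>B" by (rule prod_mono) (auto simp: B_def)
  also have "\<dots> \<le> n" by fact
  finally have "real ((z + 1) ^ card B) \<le> real n" by (rule of_nat_mono)
  then have *: "(real z + 1) ^ card B < (real z + 1) ^ m" using n by (simp add: add.commute)
  have "card B \<le> m"
  proof (rule ccontr)
    assume "\<not> card B \<le> m"
    then have "(real z + 1) ^ m \<le> (real z + 1) ^ card B" by (intro power_increasing) auto
    with * show False by simp
  qed
  with le show ?thesis by simp
qed

section \<open>Moments of \<open>omega\<close>\<close>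

lemma power_diff_le:
  fixes u v w :: real
  assumes "\<bar>u\<bar> \<le> w" "\<bar>v\<bar> \<le> w"
  shows "\<bar>u ^ k - v ^ k\<bar> \<le> real k * \<bar>u - v\<bar> * w ^ (k - 1)"
proof -
  have "\<bar>u ^ k - v ^ k\<bar> = \<bar>u - v\<bar> * \<bar>\<Sum>i<k. v ^ (k - Suc i) * u ^ i\<bar>"
    by (simp add: power_diff_sumr2 abs_mult)
  also have "\<bar>\<Sum>i<k. v ^ (k - Suc i) * u ^ i\<bar> \<le> (\<Sum>i<k. \<bar>v ^ (k - Suc i) * u ^ i\<bar>)"
    by (rule sum_abs)
  also have "\<dots> \<le> (\<Sum>i<k. w ^ (k - 1))"
  proof (rule sum_mono)
    fix i assume i: "i \<in> {..<k}"
    have "\<bar>v ^ (k - Suc i) * u ^ i\<bar> \<le> w ^ (k - Suc i) * w ^ i"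
      unfolding abs_mult power_abs using assms by (intro mult_mono power_mono) auto
    also have "\<dots> = w ^ (k - 1)" using i by (simp flip: power_add)
    finally show "\<bar>v ^ (k - Suc i) * u ^ i\<bar> \<le> w ^ (k - 1)" .
  qed
  finally have "\<bar>u ^ k - v ^ k\<bar> \<le> \<bar>u - v\<bar> * (\<Sum>i<k. w ^ (k - 1))" by (simp add: mult_left_mono)
  then show ?thesis by (simp add: mult_ac)
qed

text \<open>
  Reduces absolute moments of even order to ordinary shifted moments, which the generating
  function provides.
\<close>

lemma abs_plus_even_power_le:
  fixes y d :: real
  assumes "even j"
  shows "(\<bar>y\<bar> + d) ^ j \<le> (y + d) ^ j + (y + - d) ^ j"
proof (cases "y \<ge> 0")
  case True
  then show ?thesis using assms by (simp add: zero_le_even_power)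
next
  case False
  then have "(\<bar>y\<bar> + d) ^ j = (- (y + - d)) ^ j" by simp
  also have "\<dots> = (y + - d) ^ j" using assms by (rule power_minus_even)
  finally show ?thesis using assms by (simp add: zero_le_even_power)
qed

text \<open>
  Arithmetic-geometric mean inequality; it bounds absolute moments of odd order by the adjacent
  even ones.
\<close>

lemma odd_power_le_neighbours:
  fixes y a :: real
  assumes "y \<ge> 0" "a > 0"
  shows "y ^ Suc i \<le> (a * y ^ i + y ^ Suc (Suc i) / a) / 2"
proof -
  have "0 \<le> y ^ i * (a - y)\<^sup>2 / (2 * a)" using assms by simp
  also have "\<dots> = (a * y ^ i + y ^ Suc (Suc i) / a) / 2 - y ^ Suc i"
    using assms by (simp add: field_simps power2_eq_square)
  finally show ?thesis by simp
qed

lemma ln_ln_floor_diff_le: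
  assumes y: "y \<ge> 2"
  shows "\<bar>ln (ln y) - ln (ln (real (nat \<lfloor>y\<rfloor>)))\<bar> \<le> 1"
proof -
  define z where "z = nat \<lfloor>y\<rfloor>"
  have z: "z \<ge> 2" "real z \<le> y" "y \<le> real (Suc z)"
    using y unfolding z_def by linarith+
  have ln_z: "ln (real z) \<ge> 1 / 2"
  proof -
    have "1 - 1 / 2 \<le> ln (2::real)" using ln_le_minus_one[of "1 / 2 :: real"] by (simp add: ln_div)
    also have "\<dots> \<le> ln (real z)" using z by simp
    finally show ?thesis by simp
  qed
  have "ln y - ln (real z) \<le> ln (real (Suc z)) - ln (real z)" using y z by simp
  also have "\<dots> \<le> 1 / real z" using z by (intro ln_Suc_minus_ln_le) auto
  also have "\<dots> \<le> 1 / 2" using z by (simp add: field_simps)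
  finally have diff: "ln y - ln (real z) \<le> 1 / 2" .
  have le: "ln (real z) \<le> ln y" using y z by simp
  have "ln (ln y) - ln (ln (real z)) = ln (ln y / ln (real z))"
    using ln_z le by (simp add: ln_divide_pos)
  also have "\<dots> \<le> ln y / ln (real z) - 1" using ln_z le by (intro ln_le_minus_one) auto
  also have "\<dots> = (ln y - ln (real z)) / ln (real z)" using ln_z by (simp add: field_simps)
  also have "\<dots> \<le> (1 / 2) / (1 / 2)" using diff ln_z le by (intro frac_le) auto
  finally have "ln (ln y) - ln (ln (real z)) \<le> 1" by simp
  moreover have "ln (ln (real z)) \<le> ln (ln y)" using le ln_z by simp
  ultimately show ?thesis unfolding z_def by simp
qed

text \<open>
  The elementary inequalities on the size of \<open>k\<close>, \<open>L\<close> and \<open>y\<close> behind the uniformity. The last one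
  says that the error made in passing to the model, which will be at most
  \<open>(25 * y) ^ k = 25 ^ k * sqrt x\<close>, is \<open>O(x / sqrt L)\<close>: indeed \<open>25 ^ k\<close> and \<open>sqrt L\<close> are bounded by
  powers of \<open>ln x\<close>.
\<close>

lemma admissible_parameters:
  fixes x L y :: real and k :: nat
  assumes x: "x > 1" and k: "k \<ge> 1" and L_def: "L = ln (ln x)" and kL: "real k ^ 3 \<le> L"
    and y_def: "y = x powr (1 / (2 * real k))"
  shows "real k \<le> L" "L \<ge> 1" "y \<ge> 2" "y ^ k = sqrt x" "ln (ln y) = L - ln (2 * real k)"
    "L \<le> 8 * y" "sqrt L * 25 ^ k * sqrt x \<le> 12 ^ 6 * x"
proof -
  have "real k * 1 ^ 2 \<le> real k * real k ^ 2" using k by (intro mult_left_mono power_mono) auto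
  then show kle: "real k \<le> L" using kL by (simp add: power3_eq_cube power2_eq_square)
  then show L1: "L \<ge> 1" using k by simp
  have lnx0: "ln x > 0" using x by simp
  have expL: "exp L = ln x" using lnx0 by (simp add: L_def)
  have "(1 + L / 2) * (1 + L / 2) \<le> exp (L / 2) * exp (L / 2)"
    using L1 by (intro mult_mono exp_ge_add_one_self) auto
  also have "\<dots> = ln x" by (simp add: expL[symmetric] flip: exp_add)
  finally have lnx: "(1 + L / 2) * (1 + L / 2) \<le> ln x" .
  have lny: "ln y = ln x / (2 * real k)" using x by (simp add: y_def ln_powr)
  have y0: "y > 0" using x by (simp add: y_def)
  have lny_ge: "ln y \<ge> (1 + L / 2) * (1 + L / 2) / (2 * L)"
    unfolding lny using lnx lnx0 kle k L1 by (intro frac_le) auto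
  have y_ge: "y \<ge> 1 + ln y" using ln_le_minus_one[OF y0] by simp
  have "2 * L \<le> (1 + L / 2) * (1 + L / 2)"
    using sum_squares_ge_zero[of "L / 2 - 1" 0] by (simp add: algebra_simps)
  then have "1 \<le> (1 + L / 2) * (1 + L / 2) / (2 * L)" using L1 by simp
  with lny_ge y_ge show "y \<ge> 2" by simp
  have "L / 8 \<le> (1 + L / 2) * (1 + L / 2) / (2 * L)" using L1 by (simp add: field_simps)
  with lny_ge y_ge show "L \<le> 8 * y" by simp
  have "y ^ k = x powr (real k * (1 / (2 * real k)))"
    unfolding y_def using x by (simp add: powr_realpow[symmetric] powr_powr mult.commute)
  also have "real k * (1 / (2 * real k)) = 1 / 2" using k by simp
  finally show "y ^ k = sqrt x" using x by (simp add: powr_half_sqrt)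
  show "ln (ln y) = L - ln (2 * real k)"
    unfolding lny L_def using lnx0 k by (subst ln_divide_pos) auto
  have "sqrt L * 25 ^ k \<le> ln x * (ln x) ^ 5"
  proof (rule mult_mono)
    have "sqrt L \<le> sqrt (L ^ 2)" using L1 by (intro real_sqrt_le_mono self_le_power) auto
    also have "\<dots> = L" using L1 by simp
    also have "\<dots> \<le> ln x" using exp_ge_add_one_self[of L] expL by simp
    finally show "sqrt L \<le> ln x" .
    have e2: "2 \<le> exp (1::real)" using exp_ge_add_one_self[of 1] by simp
    have "(25::real) ^ k \<le> (2 ^ 5) ^ k" by (intro power_mono) auto
    also have "\<dots> \<le> (exp 1 ^ 5) ^ k" using e2 by (intro power_mono) auto
    also have "\<dots> = exp (real k) ^ 5" by (simp add: exp_of_nat_mult[symmetric] flip: power_mult)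
    also have "\<dots> \<le> exp L ^ 5" using kle by (intro power_mono) auto
    finally show "25 ^ k \<le> (ln x) ^ 5" by (simp add: expL)
  qed (use lnx0 in auto)
  also have "\<dots> = 12 ^ 6 * (ln x / 12) ^ 6" by (simp add: power_divide flip: power_Suc)
  also have "\<dots> \<le> 12 ^ 6 * sqrt x"
  proof (intro mult_left_mono)
    have "ln x / 12 \<le> exp (ln x / 12)"
      using exp_ge_add_one_self[of "ln x / 12"] by linarith
    then have "(ln x / 12) ^ 6 \<le> exp (ln x / 12) ^ 6"
      using lnx0 by (intro power_mono) auto
    also have "\<dots> = exp (ln x / 2)" by (simp add: exp_of_nat_mult[symmetric])
    also have "\<dots> = sqrt x" using x by (simp add: powr_half_sqrt[symmetric] powr_def)
    finally show "(ln x / 12) ^ 6 \<le> sqrt x" .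
  qed auto
  finally have "sqrt L * 25 ^ k * sqrt x \<le> 12 ^ 6 * sqrt x * sqrt x" 
    by (rule mult_right_mono) (use x in auto)
  also have "\<dots> = 12 ^ 6 * x" using x by simp
  finally show "sqrt L * 25 ^ k * sqrt x \<le> 12 ^ 6 * x" .
qed

lemma exp_minus_one_le:
  assumes "0 \<le> t" "t \<le> B * e" "0 \<le> e" "e \<le> 1" "B \<ge> (0::real)"
  shows "exp t - 1 \<le> B * exp B * e"
proof -
  have "1 + - t \<le> exp (- t)" by (rule exp_ge_add_one_self)
  then have "(1 + - t) * exp t \<le> exp (- t) * exp t" by (rule mult_right_mono) simp
  also have "\<dots> = 1" by (simp flip: exp_add)
  finally have "exp t - 1 \<le> t * exp t" by (simp add: algebra_simps)
  also have "\<dots> \<le> (B * e) * exp B"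
  proof (rule mult_mono)
    have "B * e \<le> B * 1" using assms by (intro mult_left_mono) auto
    then show "exp t \<le> exp B" using assms by simp
  qed (use assms in auto)
  finally show ?thesis by (simp add: mult_ac)
qed

text \<open>
  Moments of the number of prime factors up to \<open>x powr (1 / (2 * k))\<close>. The shift \<open>\<delta>\<close> of size up to
  \<open>2 * k\<close> costs nothing, as the mean of the model already differs from \<open>L\<close> by \<open>O(k)\<close>; it is the
  room needed later for the large prime factors.
\<close>

theorem truncated_moment_estimate:
  "\<exists>c>0. \<forall>(x::real) k j \<delta>. x > 1 \<longrightarrow> k \<ge> 1 \<longrightarrow> real k ^ 3 \<le> ln (ln x) \<longrightarrow>
     j \<le> k \<longrightarrow> \<bar>\<delta>\<bar> \<le> 2 * real k \<longrightarrow>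
     \<bar>(\<Sum>n=1..nat \<lfloor>x\<rfloor>.
          (real (omega_upto (nat \<lfloor>x powr (1 / (2 * real k))\<rfloor>) n) - ln (ln x) + \<delta>) ^ j)
        - (if even j then x * (C j * sqrt (ln (ln x)) ^ j) else 0)\<bar>
     \<le> c * (x * (C j * sqrt (ln (ln x)) ^ j) * (sqrt (real k) ^ 3 / sqrt (ln (ln x))))"
proof -
  obtain M where M: "M > 0" "\<And>n. n \<ge> 2 \<Longrightarrow> \<bar>(\<Sum>p\<in>primes_upto n. 1 / real p) - ln (ln (real n))\<bar> \<le> M"
    using mertens_second by blast
  \<comment> \<open>Mean, variance and higher moments contribute at most \<open>2\<close>, \<open>2\<close> and \<open>240\<close> times \<open>(M + 5) * \<epsilon>\<close> to the
     exponent in \<open>model_moment_estimate\<close>.\<close>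
  define B where "B = 260 * (M + 5)"
  have B: "B \<ge> 0" using M by (simp add: B_def)
  define c where "c = B * exp B + 2 * 12 ^ 6"
  have "\<bar>(\<Sum>n=1..nat \<lfloor>x\<rfloor>.
          (real (omega_upto (nat \<lfloor>x powr (1 / (2 * real k))\<rfloor>) n) - ln (ln x) + \<delta>) ^ j)
        - (if even j then x * (C j * sqrt (ln (ln x)) ^ j) else 0)\<bar>
     \<le> c * (x * (C j * sqrt (ln (ln x)) ^ j) * (sqrt (real k) ^ 3 / sqrt (ln (ln x))))"
    if x: "x > 1" and k: "k \<ge> 1" and kL: "real k ^ 3 \<le> ln (ln x)" and j: "j \<le> k"
      and \<delta>: "\<bar>\<delta>\<bar> \<le> 2 * real k"
    for x :: real and k j \<delta>
  proof -
    define L where "L = ln (ln x)"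
    define y where "y = x powr (1 / (2 * real k))"
    define z where "z = nat \<lfloor>y\<rfloor>"
    define P where "P = primes_upto z"
    define \<kappa> where "\<kappa> = sqrt (real k)"
    define \<sigma> where "\<sigma> = sqrt L"
    define \<epsilon> where "\<epsilon> = \<kappa> ^ 3 / \<sigma>"
    define s where "s = 2 * \<kappa> / \<sigma>"
    define \<mu> where "\<mu> = (\<Sum>p\<in>P. 1 / real p)"
    define V where "V = (\<Sum>p\<in>P. 1 / real p * (1 - 1 / real p))"
    note par = admissible_parameters[OF x k L_def kL[folded L_def] y_def]
    have \<kappa>: "\<kappa> \<ge> 1" "\<kappa>\<^sup>2 = real k" using k by (simp_all add: \<kappa>_def)
    have \<sigma>: "\<sigma> \<ge> 1" "\<sigma>\<^sup>2 = L" using par(2) by (simp_all add: \<sigma>_def)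
    have "\<kappa> ^ 3 = sqrt (real k ^ 3)" by (simp add: \<kappa>_def real_sqrt_power)
    also have "\<dots> \<le> \<sigma>" unfolding \<sigma>_def using kL by (intro real_sqrt_le_mono) (simp add: L_def)
    finally have \<kappa>\<sigma>: "\<kappa> ^ 3 \<le> \<sigma>" .
    have \<epsilon>: "0 \<le> \<epsilon>" "\<epsilon> \<le> 1" "1 / \<sigma> \<le> \<epsilon>"
      using \<kappa>\<sigma> \<kappa>(1) \<sigma>(1) by (auto simp: \<epsilon>_def intro!: divide_right_mono one_le_power)
    have s0: "s \<ge> 0" using \<kappa>(1) \<sigma>(1) by (simp add: s_def)
    have ks: "real k * s = 2 * \<epsilon>"
      by (simp add: s_def \<epsilon>_def \<kappa>(2)[symmetric] power2_eq_square power3_eq_cube)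
    have "1 * s \<le> real k * s" using k s0 by (intro mult_right_mono) auto
    then have s2: "s \<le> 2" using ks \<epsilon> by simp
    have z: "z \<ge> 2" "real z \<le> y" using par(3) unfolding z_def by linarith+
    have ln2k: "0 \<le> ln (2 * real k)" "ln (2 * real k) \<le> 2 * real k"
      using k ln_le_minus_one[of "2 * real k"] by auto
    have "\<bar>\<mu> - L\<bar> \<le> M + 1 + ln (2 * real k)"
      using M(2)[OF z(1)] ln_ln_floor_diff_le[OF par(3)] par(5) ln2k
      unfolding \<mu>_def P_def z_def[symmetric] by linarith
    also have "\<dots> \<le> M * real k + real k + 2 * real k"
      using ln2k k M(1) by (intro add_mono) auto
    finally have \<mu>L: "\<bar>\<mu> - L\<bar> \<le> (M + 3) * real k" by (simp add: algebra_simps)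
    have V_eq: "V = \<mu> - (\<Sum>p\<in>P. 1 / real p ^ 2)"
      unfolding V_def \<mu>_def sum_subtractf[symmetric]
      by (intro sum.cong refl) (simp add: algebra_simps power2_eq_square)
    have "0 \<le> (\<Sum>p\<in>P. 1 / real p ^ 2)" by (intro sum_nonneg) auto
    then have "\<bar>V - L\<bar> \<le> \<bar>\<mu> - L\<bar> + 1"
      using sum_inverse_squares_primes_le[of z] unfolding V_eq P_def by linarith
    also have "\<dots> \<le> (M + 3) * real k + real k" using \<mu>L k by simp
    finally have VL: "\<bar>V - L\<bar> \<le> (M + 4) * real k" by (simp add: algebra_simps)
    have "(M + 4) * real k \<le> (M + 4) * L" using par(1) M(1) by (intro mult_left_mono) auto
    with VL have V_le: "V \<le> (M + 5) * L" by (simp add: algebra_simps)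
    define t where "t = \<bar>(\<delta> - L) + \<mu>\<bar> * s + \<bar>V - \<sigma>\<^sup>2\<bar> / 2 * s\<^sup>2 + 30 * V * s ^ 3"
    have t_le: "t \<le> B * \<epsilon>"
    proof -
      have "\<bar>(\<delta> - L) + \<mu>\<bar> \<le> (M + 5) * real k" using \<mu>L \<delta> by (simp add: algebra_simps)
      then have "\<bar>(\<delta> - L) + \<mu>\<bar> * s \<le> (M + 5) * real k * s" using s0 by (rule mult_right_mono)
      also have "\<dots> = (M + 5) * (real k * s)" by simp
      finally have t1: "\<bar>(\<delta> - L) + \<mu>\<bar> * s \<le> 2 * ((M + 5) * \<epsilon>)" unfolding ks by simp
      have "\<bar>V - \<sigma>\<^sup>2\<bar> / 2 * s\<^sup>2 \<le> (M + 4) * real k / 2 * s\<^sup>2"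
        unfolding \<sigma>(2) using VL by (intro mult_right_mono divide_right_mono) auto
      also have "\<dots> = (M + 4) / 2 * (real k * s) * s" by (simp add: power2_eq_square)
      also have "\<dots> \<le> (M + 5) * \<epsilon> * 2"
        unfolding ks
      proof (rule mult_mono[OF _ s2])
        have "(M + 4) * \<epsilon> \<le> (M + 5) * \<epsilon>" using \<epsilon> by (intro mult_right_mono) auto
        then show "(M + 4) / 2 * (2 * \<epsilon>) \<le> (M + 5) * \<epsilon>" by simp
      qed (use s0 \<epsilon> M(1) in auto)
      finally have t2: "\<bar>V - \<sigma>\<^sup>2\<bar> / 2 * s\<^sup>2 \<le> 2 * ((M + 5) * \<epsilon>)" by simp
      have "30 * V * s ^ 3 \<le> 30 * ((M + 5) * \<sigma>\<^sup>2) * s ^ 3"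
        using V_le s0 \<sigma>(2) by (intro mult_right_mono) auto
      also have "\<dots> = 240 * ((M + 5) * \<epsilon>)"
        using \<sigma>(1) by (simp add: s_def \<epsilon>_def power_divide power_mult_distrib power2_eq_square power3_eq_cube)
      finally have t3: "30 * V * s ^ 3 \<le> 240 * ((M + 5) * \<epsilon>)" .
      have "(M + 5) * \<epsilon> \<ge> 0" using M(1) \<epsilon> by simp
      then have "t \<le> 260 * ((M + 5) * \<epsilon>)" unfolding t_def using t1 t2 t3 by linarith
      then show ?thesis by (simp only: B_def mult.assoc)
    qed
    \<comment> \<open>The model moment is \<open>G\<close> for even \<open>j\<close> and \<open>0\<close> for odd \<open>j\<close>, up to \<open>O(G * \<epsilon>)\<close>. The transfer adds
       an error \<open>O(x / \<sigma>)\<close>, which is within \<open>O(x * G * \<epsilon>)\<close> because \<open>G \<ge> 1 / 2\<close> and \<open>1 / \<sigma> \<le> \<epsilon>\<close>.\<close>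
    define X where "X = (\<Sum>S\<in>Pow P. prime_model z S * (real (card S) + (\<delta> - L)) ^ j)"
    define G where "G = C j * \<sigma> ^ j"
    have "1 ^ j \<le> \<sigma> ^ j" using \<sigma>(1) by (intro power_mono) auto
    then have "1 / 2 * 1 \<le> G" unfolding G_def using C_ge_half[of j] by (intro mult_mono) auto
    then have G: "1 \<le> 2 * G" by simp
    have V0: "V \<ge> 0" unfolding V_def P_def
      by (intro sum_nonneg mult_nonneg_nonneg) (auto simp: primes_upto_def dest: prime_gt_0_nat)
    have "\<bar>X - (if even j then G else 0)\<bar> \<le> G * (exp t - 1)"
      unfolding X_def G_def t_def \<mu>_def P_def
    proof (rule model_moment_estimate[where k = k])
      show "0 \<le> 1 / real p \<and> 1 / real p \<le> 1" if "p \<in> primes_upto z" for p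
        using that by (auto simp: primes_upto_def dest: prime_gt_0_nat)
      show "s = 2 * sqrt (real k) / \<sigma>" by (simp add: s_def \<kappa>_def)
      show "V = (\<Sum>p\<in>primes_upto z. 1 / real p * (1 - 1 / real p))" by (simp add: V_def P_def)
    qed (use \<sigma>(1) j s2 in auto)
    also have "\<dots> \<le> G * (B * exp B * \<epsilon>)"
    proof (intro mult_left_mono exp_minus_one_le t_le \<epsilon> B)
      show "0 \<le> t" using s0 V0 by (simp add: t_def)
    qed (use G in auto)
    finally have model: "\<bar>X - (if even j then G else 0)\<bar> \<le> G * (B * exp B * \<epsilon>)" .
    have "\<bar>(\<Sum>n=1..nat \<lfloor>x\<rfloor>. (real (omega_upto z n) + (\<delta> - L)) ^ j) - x * X\<bar> \<le> (real z + \<bar>\<delta> - L\<bar>) ^ j"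
      unfolding X_def P_def using x by (intro shifted_moment_transfer) auto
    also have "\<dots> \<le> (25 * y) ^ j"
      using z(2) \<delta> par(1,2,6) by (intro power_mono) auto
    also have "\<dots> \<le> (25 * y) ^ k" using par(3) j by (intro power_increasing) auto
    also have "\<dots> = 25 ^ k * sqrt x" by (simp add: power_mult_distrib par(4))
    also have "\<dots> = \<sigma> * 25 ^ k * sqrt x / \<sigma>" using \<sigma>(1) by simp
    also have "\<dots> \<le> 12 ^ 6 * x / \<sigma>"
      using par(7) \<sigma>(1) by (intro divide_right_mono) (auto simp: \<sigma>_def)
    also have "\<dots> = 12 ^ 6 * x * (1 / \<sigma>)" by simp
    also have "\<dots> \<le> 12 ^ 6 * x * (2 * G * \<epsilon>)"
    proof (intro mult_left_mono)
      have "1 * \<epsilon> \<le> 2 * G * \<epsilon>" using G \<epsilon>(1) by (rule mult_right_mono)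
      then show "1 / \<sigma> \<le> 2 * G * \<epsilon>" using \<epsilon>(3) by simp
    qed (use x in auto)
    finally have transfer: "\<bar>(\<Sum>n=1..nat \<lfloor>x\<rfloor>. (real (omega_upto z n) + (\<delta> - L)) ^ j) - x * X\<bar>
        \<le> 12 ^ 6 * x * (2 * G * \<epsilon>)" .
    have "\<bar>x * X - (if even j then x * G else 0)\<bar> = x * \<bar>X - (if even j then G else 0)\<bar>"
      using x by (auto simp: abs_mult simp flip: right_diff_distrib)
    also have "\<dots> \<le> x * (G * (B * exp B * \<epsilon>))" using x by (intro mult_left_mono model) auto
    finally have "\<bar>(\<Sum>n=1..nat \<lfloor>x\<rfloor>. (real (omega_upto z n) + (\<delta> - L)) ^ j) - (if even j then x * G else 0)\<bar>
        \<le> 12 ^ 6 * x * (2 * G * \<epsilon>) + x * (G * (B * exp B * \<epsilon>))"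
      using transfer by linarith
    also have "\<dots> = c * (x * G * \<epsilon>)" by (simp add: c_def algebra_simps)
    finally show ?thesis
      unfolding G_def \<epsilon>_def \<sigma>_def \<kappa>_def L_def z_def y_def by (simp add: add_diff_eq diff_add_eq)
  qed
  moreover have "c > 0" using B by (simp add: c_def add_nonneg_pos)
  ultimately show ?thesis by blast
qed

lemma C_pred_le:
  assumes "k \<ge> 1"
  shows "sqrt (real k) * C (k - 1) \<le> 2 * C k"
  using sqrt_times_C_le[of "k - 1"] assms by simp

text \<open>
  Let \<open>F n\<close> be the centred number of prime factors up to \<open>z\<close>. Replacing it by \<open>omega n - L\<close> shifts it
  by at most \<open>D = 2 * k\<close>, so the \<open>k\<close>-th moment changes by at most \<open>k * D\<close> times the absolute moment
  \<open>T (k - 1)\<close>. By the growth of \<open>C\<close>, that moment is \<open>O(x * C k * \<sigma> ^ k / (sqrt k * \<sigma>))\<close>, and the total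
  change is \<open>k powr (3/2) / \<sigma>\<close> relative to the main term.
\<close>

theorem moment_estimate:
  "\<exists>c>0. \<forall>(x::real) k. x > 1 \<longrightarrow> k \<ge> 1 \<longrightarrow> real k ^ 3 \<le> ln (ln x) \<longrightarrow>
     \<bar>omega_moment k x - (if even k then x * (C k * sqrt (ln (ln x)) ^ k) else 0)\<bar>
     \<le> c * (x * (C k * sqrt (ln (ln x)) ^ k) * (sqrt (real k) ^ 3 / sqrt (ln (ln x))))"
proof -
  obtain c where c: "c > 0" and truncated: "\<And>(x::real) k j \<delta>.
     \<lbrakk>x > 1; k \<ge> 1; real k ^ 3 \<le> ln (ln x); j \<le> k; \<bar>\<delta>\<bar> \<le> 2 * real k\<rbrakk> \<Longrightarrow>
     \<bar>(\<Sum>n=1..nat \<lfloor>x\<rfloor>.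
          (real (omega_upto (nat \<lfloor>x powr (1 / (2 * real k))\<rfloor>) n) - ln (ln x) + \<delta>) ^ j)
        - (if even j then x * (C j * sqrt (ln (ln x)) ^ j) else 0)\<bar>
     \<le> c * (x * (C j * sqrt (ln (ln x)) ^ j) * (sqrt (real k) ^ 3 / sqrt (ln (ln x))))"
    using truncated_moment_estimate by blast
  have "\<bar>omega_moment k x - (if even k then x * (C k * sqrt (ln (ln x)) ^ k) else 0)\<bar>
     \<le> (8 * (1 + c) + c) * (x * (C k * sqrt (ln (ln x)) ^ k) * (sqrt (real k) ^ 3 / sqrt (ln (ln x))))"
    if x: "x > 1" and k: "k \<ge> 1" and kL: "real k ^ 3 \<le> ln (ln x)" for x :: real and k
  proof -
    define L where "L = ln (ln x)"
    define y where "y = x powr (1 / (2 * real k))"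
    define z where "z = nat \<lfloor>y\<rfloor>"
    define N where "N = nat \<lfloor>x\<rfloor>"
    define \<kappa> where "\<kappa> = sqrt (real k)"
    define \<sigma> where "\<sigma> = sqrt L"
    define \<epsilon> where "\<epsilon> = \<kappa> ^ 3 / \<sigma>"
    define D where "D = 2 * real k"
    define G where "G j = C j * \<sigma> ^ j" for j
    define F where "F n = real (omega_upto z n) - L" for n
    define T where "T j = (\<Sum>n=1..N. (\<bar>F n\<bar> + D) ^ j)" for j
    note par = admissible_parameters[OF x k L_def kL[folded L_def] y_def]
    have \<kappa>: "\<kappa> \<ge> 1" "\<kappa>\<^sup>2 = real k" using k by (simp_all add: \<kappa>_def)
    have \<sigma>: "\<sigma> \<ge> 1" using par(2) by (simp add: \<sigma>_def)
    have "\<kappa> ^ 3 = sqrt (real k ^ 3)" by (simp add: \<kappa>_def real_sqrt_power)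
    also have "\<dots> \<le> \<sigma>" unfolding \<sigma>_def using kL by (intro real_sqrt_le_mono) (simp add: L_def)
    finally have \<kappa>\<sigma>: "\<kappa> ^ 3 \<le> \<sigma>" .
    have \<epsilon>: "0 \<le> \<epsilon>" "\<epsilon> \<le> 1" using \<kappa>\<sigma> \<kappa>(1) \<sigma> by (auto simp: \<epsilon>_def)
    have G: "G j > 0" for j using \<sigma> by (simp add: G_def C_pos)
    have trunc: "\<bar>(\<Sum>n=1..N. (F n + \<delta>) ^ j) - (if even j then x * G j else 0)\<bar> \<le> c * (x * G j * \<epsilon>)"
      if "j \<le> k" "\<bar>\<delta>\<bar> \<le> D" for j \<delta>
      using truncated[OF x k kL that(1) that(2)[unfolded D_def]]
      unfolding F_def G_def \<epsilon>_def \<sigma>_def \<kappa>_def L_def z_def y_def N_def .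
    have T_even: "T j \<le> 2 * (1 + c) * (x * G j)" if "even j" "j \<le> k" for j
    proof -
      have "T j \<le> (\<Sum>n=1..N. (F n + D) ^ j + (F n + - D) ^ j)"
        unfolding T_def by (intro sum_mono abs_plus_even_power_le that)
      also have "\<dots> = (\<Sum>n=1..N. (F n + D) ^ j) + (\<Sum>n=1..N. (F n + - D) ^ j)"
        by (rule sum.distrib)
      also have "\<dots> \<le> 2 * (x * G j) + 2 * (c * (x * G j * \<epsilon>))"
        using trunc[of j D] trunc[of j "- D"] that by (simp add: D_def)
      also have "c * (x * G j * \<epsilon>) \<le> c * (x * G j * 1)"
        using c x G[of j] \<epsilon> by (intro mult_left_mono) auto
      finally show ?thesis by (simp add: algebra_simps)
    qed
    have T_pred: "T (k - 1) \<le> 4 * (1 + c) * (x * (G k / (\<kappa> * \<sigma>)))"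
    proof (cases "even k")
      case False
      have "\<kappa> * C (k - 1) \<le> 2 * C k" unfolding \<kappa>_def by (rule C_pred_le[OF k])
      then have "\<kappa> * C (k - 1) * \<sigma> ^ k \<le> 2 * C k * \<sigma> ^ k" using \<sigma> by (intro mult_right_mono) auto
      moreover have "\<sigma> ^ k = \<sigma> ^ (k - 1) * \<sigma>" using k by (cases k) auto
      ultimately have "G (k - 1) * (\<kappa> * \<sigma>) \<le> 2 * G k" by (simp add: G_def mult_ac)
      then have *: "G (k - 1) \<le> 2 * (G k / (\<kappa> * \<sigma>))"
        using \<kappa>(1) \<sigma> by (simp add: pos_le_divide_eq)
      have "T (k - 1) \<le> 2 * (1 + c) * (x * G (k - 1))"
        using False by (intro T_even) auto
      also have "\<dots> \<le> 2 * (1 + c) * (x * (2 * (G k / (\<kappa> * \<sigma>))))"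
        using c x by (intro mult_left_mono *) auto
      also have "2 * (1 + c) * (x * (2 * g)) = 4 * (1 + c) * (x * g)" for g
        by (simp add: algebra_simps)
      finally show ?thesis .
    next
      case True
      with k obtain i where i: "k = Suc (Suc i)" "even i"
        by (metis One_nat_def even_Suc not0_implies_Suc not_one_le_zero odd_one)
      \<comment> \<open>\<open>sqrt k * \<sigma>\<close> is the ratio of \<open>G k\<close> to \<open>G (k - 1)\<close> up to constants, and so balances the
         contributions of the two neighbouring even moments.\<close>
      define a where "a = \<kappa> * \<sigma>"
      have a: "a > 0" using \<kappa>(1) \<sigma> by (simp add: a_def)
      have D: "D \<ge> 0" by (simp add: D_def)
      have "T (k - 1) \<le> (\<Sum>n=1..N. (a * (\<bar>F n\<bar> + D) ^ i + (\<bar>F n\<bar> + D) ^ k / a) / 2)"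
        unfolding T_def i(1) diff_Suc_1 using a D by (intro sum_mono odd_power_le_neighbours) auto
      also have "\<dots> = (a * T i + T k / a) / 2"
        by (simp add: T_def sum.distrib sum_distrib_left flip: sum_divide_distrib)
      also have "\<dots> \<le> (a * (2 * (1 + c) * (x * G i)) + 2 * (1 + c) * (x * G k) / a) / 2"
        using i a True by (intro divide_right_mono add_mono mult_left_mono T_even) auto
      also have "\<dots> = (1 + c) * (x * (a * G i + G k / a))" using a by (simp add: field_simps)
      also have "\<dots> \<le> (1 + c) * (x * (2 * (G k / a) + G k / a))"
      proof -
        have "real k * C i \<le> 2 * ((real i + 1) * C i)"
          using C_pos[of i] unfolding i(1) mult.assoc[symmetric] by (intro mult_right_mono) auto
        then have "\<kappa> * \<kappa> * C i \<le> 2 * C k" using \<kappa>(2) by (simp add: i(1) C_Suc_Suc power2_eq_square)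
        then have "\<kappa> * \<kappa> * C i * \<sigma> ^ k \<le> 2 * C k * \<sigma> ^ k" using \<sigma> by (intro mult_right_mono) auto
        then have "a * G i * a \<le> 2 * G k" by (simp add: G_def a_def i(1) mult_ac)
        then have "a * G i \<le> 2 * (G k / a)" using a by (simp add: pos_le_divide_eq)
        then show ?thesis using c x by (intro mult_left_mono add_right_mono) auto
      qed
      also have "\<dots> = 3 * ((1 + c) * (x * (G k / a)))" by (simp add: algebra_simps)
      also have "\<dots> \<le> 4 * ((1 + c) * (x * (G k / a)))"
        using c x G[of k] a by (intro mult_right_mono) auto
      finally show ?thesis by (simp only: a_def mult.assoc)
    qed
    have "omega_moment k x = (\<Sum>n=1..N. (real (omega n) - L) ^ k)"
    proof -
      have "real n \<le> x \<longleftrightarrow> n \<le> N" for n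
        using x by (simp add: N_def le_nat_iff le_floor_iff)
      then have "{n. 1 \<le> n \<and> real n \<le> x} = {n. 1 \<le> n \<and> n \<le> N}" by (simp only:)
      also have "\<dots> = {1..N}" by auto
      finally have "{n. 1 \<le> n \<and> real n \<le> x} = {1..N}" .
      then show ?thesis by (simp add: omega_moment_def L_def)
    qed
    then have "\<bar>omega_moment k x - (\<Sum>n=1..N. F n ^ k)\<bar> = \<bar>\<Sum>n=1..N. (real (omega n) - L) ^ k - F n ^ k\<bar>"
      by (simp add: sum_subtractf)
    also have "\<dots> \<le> (\<Sum>n=1..N. \<bar>(real (omega n) - L) ^ k - F n ^ k\<bar>)" by (rule sum_abs)
    also have "\<dots> \<le> (\<Sum>n=1..N. real k * D * (\<bar>F n\<bar> + D) ^ (k - 1))"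
    proof (rule sum_mono)
      fix n assume n: "n \<in> {1..N}"
      have "y < real z + 1" using par(3) unfolding z_def by linarith
      have "y ^ (2 * k) = x" using par(4) x by (simp add: power_mult mult.commute[of 2])
      have "real n \<le> x" using n x unfolding N_def by simp linarith
      also have "x = y ^ (2 * k)" by (rule \<open>y ^ (2 * k) = x\<close>[symmetric])
      also have "\<dots> < (real z + 1) ^ (2 * k)"
        using \<open>y < real z + 1\<close> par(3) k by (intro power_strict_mono) auto
      finally have "omega n \<le> omega_upto z n + 2 * k" using n by (intro omega_le_omega_upto) auto
      moreover have "omega_upto z n \<le> omega n" using n by (intro omega_upto_le_omega) auto
      ultimately have d: "\<bar>(real (omega n) - L) - F n\<bar> \<le> D" by (simp add: F_def D_def)
      have "\<bar>(real (omega n) - L) ^ k - F n ^ k\<bar> \<le> real k * \<bar>(real (omega n) - L) - F n\<bar> * (\<bar>F n\<bar> + D) ^ (k - 1)"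
        using d by (intro power_diff_le) auto
      also have "\<dots> \<le> real k * D * (\<bar>F n\<bar> + D) ^ (k - 1)"
        using d by (intro mult_right_mono mult_left_mono) auto
      finally show "\<bar>(real (omega n) - L) ^ k - F n ^ k\<bar> \<le> real k * D * (\<bar>F n\<bar> + D) ^ (k - 1)" .
    qed
    also have "\<dots> = real k * D * T (k - 1)" by (simp add: T_def sum_distrib_left)
    also have "\<dots> \<le> real k * D * (4 * (1 + c) * (x * (G k / (\<kappa> * \<sigma>))))"
      by (intro mult_left_mono T_pred) (simp add: D_def)
    also have "real k * D = 2 * \<kappa> ^ 4" by (simp add: D_def \<kappa>(2)[symmetric] flip: power_add)
    also have "2 * \<kappa> ^ 4 * (4 * (1 + c) * (x * (G k / (\<kappa> * \<sigma>)))) = 8 * (1 + c) * (x * G k * \<epsilon>)"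
      using \<kappa>(1) \<sigma> by (simp add: \<epsilon>_def power4_eq_xxxx power3_eq_cube)
    finally have "\<bar>omega_moment k x - (\<Sum>n=1..N. F n ^ k)\<bar> \<le> 8 * (1 + c) * (x * G k * \<epsilon>)" .
    moreover have "\<bar>(\<Sum>n=1..N. F n ^ k) - (if even k then x * G k else 0)\<bar> \<le> c * (x * G k * \<epsilon>)"
      using trunc[of k 0] by (simp add: D_def)
    ultimately have "\<bar>omega_moment k x - (if even k then x * G k else 0)\<bar>
        \<le> 8 * (1 + c) * (x * G k * \<epsilon>) + c * (x * G k * \<epsilon>)" by linarith
    also have "\<dots> = (8 * (1 + c) + c) * (x * G k * \<epsilon>)" by (simp add: distrib_right)
    finally show ?thesis
      unfolding G_def \<epsilon>_def \<sigma>_def \<kappa>_def L_def .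
  qed
  moreover have "8 * (1 + c) + c > 0" using c by simp
  ultimately show ?thesis by blast
qed

theorem theorem1:
  "(\<exists>c>0. \<forall>(x::real) (k::nat).
       x > 1 \<longrightarrow> k \<ge> 1 \<longrightarrow> even k \<longrightarrow> real k \<le> root 3 (ln (ln x)) \<longrightarrow>
       (\<exists>E::real. \<bar>E\<bar> \<le> c * (real k powr (3/2) / sqrt (ln (ln x))) \<and>
          omega_moment k x = C k * x * ln (ln x) powr (real k / 2) * (1 + E)))
   \<and>
   (\<exists>c>0. \<forall>(x::real) (k::nat).
       x > 1 \<longrightarrow> k \<ge> 1 \<longrightarrow> odd k \<longrightarrow> real k \<le> root 3 (ln (ln x)) \<longrightarrow>
       \<bar>omega_moment k x\<bar>
         \<le> c * (C k * x * ln (ln x) powr (real k / 2) * (real k powr (3/2) / sqrt (ln (ln x)))))"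
proof -
  obtain c where c: "c > 0" and estimate: "\<And>(x::real) k. \<lbrakk>x > 1; k \<ge> 1; real k ^ 3 \<le> ln (ln x)\<rbrakk> \<Longrightarrow>
     \<bar>omega_moment k x - (if even k then x * (C k * sqrt (ln (ln x)) ^ k) else 0)\<bar>
     \<le> c * (x * (C k * sqrt (ln (ln x)) ^ k) * (sqrt (real k) ^ 3 / sqrt (ln (ln x))))"
    using moment_estimate by blast
  define M where "M x k = C k * x * ln (ln x) powr (real k / 2)" for x k
  define e where "e x k = real k powr (3/2) / sqrt (ln (ln x))" for x k
  have main: "M x k > 0 \<and> \<bar>omega_moment k x - (if even k then M x k else 0)\<bar> \<le> c * (M x k * e x k)"
    if x: "x > 1" and k: "k \<ge> 1" and kL: "real k \<le> root 3 (ln (ln x))" for x k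
  proof -
    \<comment> \<open>The range of \<open>k\<close> forces \<open>ln (ln x)\<close> to be positive.\<close>
    have "0 < root 3 (ln (ln x))" using k kL by linarith
    then have L: "ln (ln x) > 0" by simp
    have "real k ^ 3 \<le> root 3 (ln (ln x)) ^ 3" using kL by (intro power_mono) auto
    also have "\<dots> = ln (ln x)" using L by (simp add: real_root_pow_pos2)
    finally have k3: "real k ^ 3 \<le> ln (ln x)" .
    have half_power: "a powr (real m / 2) = sqrt a ^ m" if "a > 0" for a :: real and m
    proof -
      have "a powr (real m / 2) = (a powr (1 / 2)) powr real m" by (simp add: powr_powr)
      also have "\<dots> = sqrt a ^ m" using that by (simp add: powr_half_sqrt powr_realpow)
      finally show ?thesis .
    qed
    have M_eq: "M x k = x * (C k * sqrt (ln (ln x)) ^ k)"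
      unfolding M_def half_power[OF L] by simp
    have e_eq: "e x k = sqrt (real k) ^ 3 / sqrt (ln (ln x))"
      unfolding e_def using half_power[of "real k" 3] k by simp
    have "M x k > 0" unfolding M_eq using x L C_pos[of k] by simp
    with estimate[OF x k k3] show ?thesis unfolding M_eq e_eq by simp
  qed
  show ?thesis
  proof (rule conjI; rule exI[of _ c]; intro conjI allI impI c)
    fix x :: real and k :: nat
    assume x: "x > 1" "k \<ge> 1" "even k" "real k \<le> root 3 (ln (ln x))"
    define E where "E = (omega_moment k x - M x k) / M x k"
    have M: "M x k > 0" and bound: "\<bar>omega_moment k x - M x k\<bar> \<le> c * (M x k * e x k)"
      using main[OF x(1,2,4)] x(3) by auto
    have "\<bar>E\<bar> = \<bar>omega_moment k x - M x k\<bar> / M x k" using M by (simp add: E_def)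
    also have "\<dots> \<le> c * (M x k * e x k) / M x k" using M bound by (intro divide_right_mono) auto
    also have "\<dots> = c * e x k" using M by simp
    finally have "\<bar>E\<bar> \<le> c * e x k" .
    moreover have "omega_moment k x = M x k * (1 + E)" using M by (simp add: E_def field_simps)
    ultimately show "\<exists>E. \<bar>E\<bar> \<le> c * (real k powr (3 / 2) / sqrt (ln (ln x))) \<and>
        omega_moment k x = C k * x * ln (ln x) powr (real k / 2) * (1 + E)"
      unfolding M_def e_def by blast
  next
    fix x :: real and k :: nat
    assume "x > 1" "k \<ge> 1" "odd k" "real k \<le> root 3 (ln (ln x))"
    with main[of x k] show "\<bar>omega_moment k x\<bar>
        \<le> c * (C k * x * ln (ln x) powr (real k / 2) * (real k powr (3 / 2) / sqrt (ln (ln x))))"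
      unfolding M_def e_def by simp
  qed
qed

end
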